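(* Let $f\in K((x))[y]$ be a monic reduced polynomial with $\xi(f)$ irreducible components in $K((x))[y]$, and assume that $f$ is generic in the sense that $\mathrm{int}(f,H)\le0$ for every irreducible component $H$ of $f_y$. Then the number of irregular values of $f$, i.e. the cardinality of $\mathrm{irreg}(f)$, is at most $\xi(f)$.
   Context: $K$ is an algebraically closed field of characteristic $0$; $f_y$ is the $y$-derivative of $f$; "irreducible components" are monic irreducible factors in $K((x))[y]$. For a monic irreducible $H\in K((x))[y]$ of degree $n_H$ in $y$ and $F\in K((x))[y]$, $\mathrm{int}(F,H)=n_H\,O_xF(x,\gamma(x))$, where $\gamma(x)\in K((x^{1/n_H}))$ is any root of $H(x,y)=0$ and $O_x$ is the order in $x$. If $H$ is an irreducible component of $f_y$ with $\mathrm{int}(f,H)=0$ and $\gamma$ is a root of $H$, then $f(x,\gamma(x))=\lambda+u(x)$ with $\lambda\in K^*$ and $u(0)=0$; such a $\lambda$ is called an irregular value of $f$ (with respect to $f_y$). $\mathrm{irreg}(f)$ is the set of all irregular values obtained in this way from all irreducible components $H$ of $f_y$ with $\mathrm{int}(f,H)=0$. *)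

theory Defs
  imports
    "HOL-Computational_Algebra.Computational_Algebra"
    "HOL-Library.Extended_Real"
begin

text \<open>
  \<open>K((x))[y]\<close> is \<open>'a fls poly\<close>. A series \<open>\<gamma>(x) \<in> K((x\<^sup>1\<^sup>/\<^sup>n))\<close> is encoded, for \<open>n > 0\<close>, by
  the pair of \<open>n\<close> and the \<open>g \<in> K((t))\<close> with \<open>\<gamma>(x) = g(x\<^sup>1\<^sup>/\<^sup>n)\<close>, so that \<open>t = x\<^sup>1\<^sup>/\<^sup>n\<close>
  and \<open>F(x, \<gamma>(x))\<close> is encoded by \<open>F(t\<^sup>n, g(t))\<close>.
\<close>

definition puiseux_eval :: "'a::field fls poly \<Rightarrow> nat \<Rightarrow> 'a fls \<Rightarrow> 'a fls" where
  "puiseux_eval F n g = poly (map_poly (\<lambda>c. fls_compose_power c n) F) g"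

text \<open>
  The order in \<open>x\<close> (not in \<open>t\<close>). The library sets \<open>fls_subdegree 0 = 0\<close>, whereas the zero
  series has order \<open>\<infinity>\<close>.
\<close>

definition puiseux_ord :: "nat \<Rightarrow> 'a::zero fls \<Rightarrow> ereal" where
  "puiseux_ord n g = (if g = 0 then \<infinity> else ereal (of_int (fls_subdegree g) / of_nat n))"

definition puiseux_root :: "'a::field fls poly \<Rightarrow> 'a fls \<Rightarrow> bool" where
  "puiseux_root H g \<longleftrightarrow> puiseux_eval H (degree H) g = 0"

text \<open>
  Only meaningful for monic irreducible \<open>H\<close>, over an algebraically closed field of
  characteristic 0; then a root exists and the value does not depend on which one is chosen.
\<close>

definition int_mult :: "'a::field fls poly \<Rightarrow> 'a fls poly \<Rightarrow> ereal" where
  "int_mult F H =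
     ereal (of_nat (degree H)) *
     puiseux_ord (degree H) (puiseux_eval F (degree H) (SOME g. puiseux_root H g))"

text \<open>
  The zero polynomial has no factorization and is given no components. This only matters
  for \<open>f = 1\<close>, where \<open>f\<^sub>y = 0\<close>.
\<close>

definition irreducible_components :: "'a::field fls poly \<Rightarrow> 'a fls poly set" where
  "irreducible_components F = {H. F \<noteq> 0 \<and> lead_coeff H = 1 \<and> irreducible H \<and> H dvd F}"

definition irreg :: "'a::field fls poly \<Rightarrow> 'a set" where
  "irreg f =
     {c. c \<noteq> 0 \<and>
       (\<exists>H \<in> irreducible_components (pderiv f). int_mult f H = 0 \<and>
         (\<exists>g u. puiseux_root H g \<and> fps_nth u 0 = 0 \<and>
           puiseux_eval f (degree H) g = fls_const c + fps_to_fls u))}"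

end

theory Submission
  imports Defs
begin

text \<open>
  Choose \<open>N\<close> such that \<open>f\<close> splits over \<open>K((t))\<close> with \<open>x = t\<^sup>N\<close>. If \<open>\<gamma>\<close> is a root of \<open>f\<^sub>y\<close> with
  \<open>f(\<gamma>)\<close> of order \<open>\<ge> 0\<close>, there is a unique \<open>h\<close> for which \<open>f(\<gamma> + t\<^sup>h s)\<close> has coefficients in \<open>K[[t]]\<close>
  and a nonconstant residue \<open>P(s)\<close> at \<open>t = 0\<close>. The irregular values coming from points of the ball
  \<open>\<gamma> + t\<^sup>h K[[t]]\<close> are nonzero critical values of \<open>P\<close>, and the roots of \<open>P\<close> are the residues of the roots of
  \<open>f\<close> in that ball. A polynomial has fewer nonzero critical values than distinct roots. The Galois group
  \<open>t \<mapsto> \<zeta> t\<close> permutes the balls, its orbits on the roots of \<open>f\<close> correspond to the irreducible components,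
  and the stabilizer of a ball acts on \<open>s\<close> by affine maps that preserve \<open>P\<close>; counting modulo these symmetries
  gives at most as many critical values as orbits of roots. Nonconjugate balls contain roots of
  different components.
\<close>

unbundle fps_syntax

section \<open>Ring homomorphisms and polynomials\<close>

text \<open>Four maps act on coefficients below: the constant term of a power series, the inclusion
  of power series in Laurent series, \<open>t\<close> to \<open>t^n\<close>, and \<open>t\<close> to
  \<open>\<zeta> t\<close>. Only the first has a kernel, hence the two locales.\<close>

locale idom_hom =
  fixes hom :: "'a::idom \<Rightarrow> 'b::idom"
  assumes hom_add: "hom (x + y) = hom x + hom y"
    and hom_mult: "hom (x * y) = hom x * hom y"
    and hom_1: "hom 1 = 1"
begin

lemma hom_0 [simp]: "hom 0 = 0"
  using hom_add[of 0 0] by (metis add_0 add_cancel_right_left)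

lemma hom_uminus: "hom (- x) = - hom x"
  using hom_add[of x "- x"] by (simp add: add_eq_0_iff)

lemma hom_diff: "hom (x - y) = hom x - hom y"
  using hom_add[of x "- y"] by (simp add: hom_uminus)

lemma hom_of_nat: "hom (of_nat n) = of_nat n"
  by (induction n) (simp_all add: hom_add hom_1)

lemma hom_sum: "hom (sum f A) = (\<Sum>x\<in>A. hom (f x))"
  by (induction A rule: infinite_finite_induct) (simp_all add: hom_add)

lemma coeff_map_poly_hom [simp]: "coeff (map_poly hom p) i = hom (coeff p i)"
  by (simp add: coeff_map_poly)

lemma map_poly_hom_pCons [simp]: "map_poly hom (pCons c p) = pCons (hom c) (map_poly hom p)"
  by (rule map_poly_pCons) simp

lemma map_poly_hom_add: "map_poly hom (p + q) = map_poly hom p + map_poly hom q"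
  by (rule poly_eqI) (simp add: hom_add)

lemma map_poly_hom_smult: "map_poly hom (smult c p) = smult (hom c) (map_poly hom p)"
  by (rule poly_eqI) (simp add: hom_mult)

lemma map_poly_hom_mult: "map_poly hom (p * q) = map_poly hom p * map_poly hom q"
  by (rule poly_eqI) (simp add: coeff_mult hom_sum hom_mult)

lemma map_poly_hom_1 [simp]: "map_poly hom 1 = 1"
  by (simp add: hom_1)

lemma map_poly_hom_prod_mset:
  "map_poly hom (\<Prod>x\<in>#A. f x) = (\<Prod>x\<in>#A. map_poly hom (f x))"
  by (induction A) (simp_all add: map_poly_hom_mult)

lemma map_poly_hom_dvd: "p dvd q \<Longrightarrow> map_poly hom p dvd map_poly hom q"
  by (auto simp: map_poly_hom_mult elim!: dvdE)

lemma poly_map_poly_hom: "poly (map_poly hom p) (hom x) = hom (poly p x)"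
  by (induction p) (simp_all add: hom_add hom_mult)

lemma map_poly_hom_pcompose: "map_poly hom (pcompose p q) = pcompose (map_poly hom p) (map_poly hom q)"
  by (induction p) (simp_all add: pcompose_pCons map_poly_hom_add map_poly_hom_mult)

lemma map_poly_hom_pderiv: "map_poly hom (pderiv p) = pderiv (map_poly hom p)"
  by (rule poly_eqI) (simp add: coeff_pderiv hom_mult hom_add hom_of_nat hom_1)

lemma degree_map_poly_hom_le: "degree (map_poly hom p) \<le> degree p"
  by (rule degree_le) (simp add: coeff_eq_0)

end

locale inj_idom_hom = idom_hom +
  assumes hom_eq_0: "hom x = 0 \<Longrightarrow> x = 0"
begin

lemma hom_eq_0_iff [simp]: "hom x = 0 \<longleftrightarrow> x = 0"
  using hom_eq_0 by auto

lemma hom_eq_iff: "hom x = hom y \<longleftrightarrow> x = y"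
  using hom_eq_0_iff[of "x - y"] by (simp del: hom_eq_0_iff add: hom_diff)

lemma degree_map_poly_hom [simp]: "degree (map_poly hom p) = degree p"
  by (rule degree_map_poly) simp

lemma map_poly_hom_eq_0_iff [simp]: "map_poly hom p = 0 \<longleftrightarrow> p = 0"
  by (rule map_poly_eq_0_iff) auto

lemma map_poly_hom_eq_iff: "map_poly hom p = map_poly hom q \<longleftrightarrow> p = q"
  by (auto simp: poly_eq_iff hom_eq_iff)

end

interpretation fps_nth_0_hom: idom_hom "\<lambda>c :: 'a::idom fps. fps_nth c 0"
  by unfold_locales auto

interpretation fps_to_fls_hom: inj_idom_hom "fps_to_fls :: 'a::idom fps \<Rightarrow> 'a fls"
  by unfold_locales (auto simp: fls_times_fps_to_fls)

section \<open>Hensel's lemma for power series\<close>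

abbreviation residue_poly :: "'a::idom fps poly \<Rightarrow> 'a poly" where
  "residue_poly \<equiv> map_poly (\<lambda>c. fps_nth c 0)"

lemma coeff_mult_eq_0_if_bounds:
  fixes p q :: "'a::comm_semiring_0 poly"
  assumes "\<And>i. i \<ge> m \<Longrightarrow> coeff p i = 0" "\<And>i. i \<ge> n \<Longrightarrow> coeff q i = 0" "i \<ge> m + n"
  shows "coeff (p * q) i = 0"
  unfolding coeff_mult
proof (rule sum.neutral, rule ballI)
  fix j assume "j \<in> {..i}"
  then have "j \<ge> m \<or> i - j \<ge> n" using assms(3) by auto
  then show "coeff p j * coeff q (i - j) = 0" using assms(1,2) by auto
qed

text \<open>Multiplying the Bezout relation by \<open>R\<close> gives some solution; reducing
  \<open>v * R\<close> modulo \<open>g\<close> makes \<open>a\<close> small, and comparing leading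
  coefficients in \<open>g * b = R - a * h\<close> then bounds \<open>b\<close>. Bounds on
  coefficients rather than on \<open>degree\<close> also force \<open>a = 0\<close> when
  \<open>g\<close> is constant.\<close>

lemma bezout_solve:
  fixes g h u v R :: "'a::field poly"
  assumes g: "g \<noteq> 0" and h: "h \<noteq> 0" and uv: "u * g + v * h = 1"
    and R: "\<And>i. i \<ge> degree g + degree h \<Longrightarrow> coeff R i = 0"
  shows "\<exists>a b. (\<forall>i\<ge>degree g. coeff a i = 0) \<and> (\<forall>i\<ge>degree h. coeff b i = 0) \<and> g * b + a * h = R"
proof -
  define a where "a = (v * R) mod g"
  define q where "q = (v * R) div g"
  have "v * R = q * g + a" by (simp add: a_def q_def)
  then have "R - a * h = R * (u * g + v * h) - (v * R - q * g) * h"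
    by (simp add: uv)
  also have "\<dots> = g * (R * u + q * h)" by (simp add: algebra_simps)
  finally obtain b where b: "R - a * h = g * b" by blast
  have a: "coeff a i = 0" if "i \<ge> degree g" for i
    using degree_mod_less[OF g, of "v * R"] that coeff_eq_0[of a i]
    by (auto simp: a_def[symmetric])
  have ah: "coeff (a * h) i = 0" if "i \<ge> degree g + degree h" for i
  proof (cases "a = 0")
    case False
    then have "degree a < degree g"
      using degree_mod_less[OF g, of "v * R"] by (auto simp: a_def)
    then show ?thesis using that False h by (intro coeff_eq_0) (simp add: degree_mult_eq)
  qed simp
  have "coeff b i = 0" if "i \<ge> degree h" for i
  proof (cases "b = 0")
    case False
    have "degree b < degree h"
    proof (rule ccontr)
      assume "\<not> degree b < degree h"
      then have "coeff (R - a * h) (degree g + degree b) = 0"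
        using R ah by simp
      then have "lead_coeff g * lead_coeff b = 0"
        unfolding b by (simp only: coeff_mult_degree_sum)
      with False g show False by simp
    qed
    with that show ?thesis by (intro coeff_eq_0) simp
  qed simp
  with a b show ?thesis by (intro exI[of _ a] exI[of _ b]) (auto simp: algebra_simps)
qed

text \<open>
  The coefficients of \<open>t\<^sup>k\<close> in the two factors are found recursively in \<open>k\<close>, by solving
  \<open>g * b + a * h = R\<close> with \<open>R\<close> known from the earlier coefficients.
\<close>
lemma hensel_factorization:
  fixes F :: "'a::field fps poly" and g h :: "'a poly"
  assumes F: "lead_coeff F = 1" and gh: "residue_poly F = g * h"
    and g: "lead_coeff g = 1" and uv: "u * g + v * h = 1"
  shows "\<exists>G H. F = G * H \<and> residue_poly G = g \<and> lead_coeff G = 1 \<and> degree G = degree g"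
proof -
  define T where "T k = map_poly (\<lambda>c. fps_nth c k) F" for k
  have coeff_T: "coeff (T k) i = fps_nth (coeff F i) k" for k i
    by (simp add: T_def coeff_map_poly)
  have lead: "coeff (residue_poly F) (degree F) = 1" using F by simp
  have degF: "degree (residue_poly F) = degree F"
    using lead fps_nth_0_hom.degree_map_poly_hom_le[of F]
    by (metis le_antisym le_degree zero_neq_one)
  have g0: "g \<noteq> 0" using g by auto
  have h0: "h \<noteq> 0" using lead gh by auto
  have deg: "degree F = degree g + degree h"
    using degF g0 h0 by (simp add: gh degree_mult_eq)
  \<comment> \<open>The leading coefficient of \<open>F\<close> is the constant series
    \<open>1\<close>, so it contributes to \<open>T 0\<close> only. The higher \<open>T k\<close>
    thus meet the degree bound that \<open>bezout_solve\<close> asks for.\<close>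
  have T_bound: "coeff (T k) i = 0" if "k > 0" "i \<ge> degree g + degree h" for k i
    using that F deg coeff_eq_0[of F i] by (cases "i = degree F") (auto simp: coeff_T)
  define P where "P = (\<lambda>f k r. if k = (0::nat) then r = (g, h) else
      (\<forall>i\<ge>degree g. coeff (fst r) i = 0) \<and> (\<forall>i\<ge>degree h. coeff (snd r) i = 0) \<and>
      g * snd r + fst r * h = T k - (\<Sum>l=1..<k. fst (f l) * snd (f (k - l))))"
  have "\<exists>f. \<forall>k. P f k (f k)"
  proof (rule dependent_wellorder_choice)
    show "P f x r = P f' x r" if "\<And>y. y < x \<Longrightarrow> f y = f' y" for r x and f f' :: "nat \<Rightarrow> 'a poly \<times> 'a poly"
    proof -
      have "(\<Sum>l=1..<x. fst (f l) * snd (f (x - l))) = (\<Sum>l=1..<x. fst (f' l) * snd (f' (x - l)))"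
        using that by (intro sum.cong) auto
      then show ?thesis by (simp add: P_def)
    qed
  next
    fix k :: nat and f
    assume IH: "\<And>y. y < k \<Longrightarrow> P f y (f y)"
    show "\<exists>r. P f k r"
    proof (cases "k = 0")
      case False
      have "coeff (fst (f l) * snd (f (k - l))) i = 0"
        if "l \<in> {1..<k}" "i \<ge> degree g + degree h" for l i
        using IH[of l] IH[of "k - l"] that
        by (intro coeff_mult_eq_0_if_bounds[of "degree g" _ "degree h"]) (auto simp: P_def)
      then have "coeff (T k - (\<Sum>l=1..<k. fst (f l) * snd (f (k - l)))) i = 0"
        if "i \<ge> degree g + degree h" for i
        using that T_bound False by (simp add: coeff_sum)
      from bezout_solve[OF g0 h0 uv this] False show ?thesis by (auto simp: P_def)
    qed (simp add: P_def)
  qed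
  then obtain f where f: "\<And>k. P f k (f k)" by blast
  define a b where "a k = fst (f k)" and "b k = snd (f k)" for k
  have ab0: "a 0 = g" "b 0 = h" using f[of 0] by (auto simp: P_def a_def b_def)
  have ab: "(\<forall>i\<ge>degree g. coeff (a k) i = 0) \<and> (\<forall>i\<ge>degree h. coeff (b k) i = 0) \<and>
      g * b k + a k * h = T k - (\<Sum>l=1..<k. a l * b (k - l))" if "k > 0" for k
    using f[of k] that by (auto simp: P_def a_def b_def)
  have abT: "(\<Sum>l=0..k. a l * b (k - l)) = T k" for k
  proof (cases "k = 0")
    case True
    then show ?thesis using gh by (simp add: ab0 T_def)
  next
    case False
    then have "{0..k} = insert 0 (insert k {1..<k})" by auto
    then have "(\<Sum>l=0..k. a l * b (k - l)) = g * b k + (a k * h + (\<Sum>l=1..<k. a l * b (k - l)))"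
      using False by (simp add: ab0)
    with ab[of k] False show ?thesis by (simp add: algebra_simps)
  qed
  define G where "G = (\<Sum>j\<le>degree g. monom (Abs_fps (\<lambda>k. coeff (a k) j)) j)"
  define H where "H = (\<Sum>j\<le>degree h. monom (Abs_fps (\<lambda>k. coeff (b k) j)) j)"
  have a_bound: "coeff (a k) j = 0" if "j > degree g" for j k
    using that ab[of k] ab0 by (cases "k = 0") (auto intro: coeff_eq_0)
  have b_bound: "coeff (b k) j = 0" if "j > degree h" for j k
    using that ab[of k] ab0 by (cases "k = 0") (auto intro: coeff_eq_0)
  have G: "fps_nth (coeff G j) k = coeff (a k) j" for j k
    using a_bound[of j k] by (auto simp: G_def coeff_sum fps_sum_nth not_le if_distrib cong: if_cong)
  have H: "fps_nth (coeff H j) k = coeff (b k) j" for j k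
    using b_bound[of j k] by (auto simp: H_def coeff_sum fps_sum_nth not_le if_distrib cong: if_cong)
  have "F = G * H"
  proof (rule poly_eqI, rule fps_ext)
    fix j k
    have "fps_nth (coeff (G * H) j) k = (\<Sum>i\<le>j. \<Sum>l=0..k. coeff (a l) i * coeff (b (k - l)) (j - i))"
      by (simp add: coeff_mult fps_sum_nth fps_mult_nth G H)
    also have "\<dots> = (\<Sum>l=0..k. \<Sum>i\<le>j. coeff (a l) i * coeff (b (k - l)) (j - i))"
      by (rule sum.swap)
    also have "\<dots> = coeff (\<Sum>l=0..k. a l * b (k - l)) j"
      by (simp add: coeff_sum coeff_mult)
    finally show "fps_nth (coeff F j) k = fps_nth (coeff (G * H) j) k"
      by (simp add: abT coeff_T)
  qed
  moreover have "residue_poly G = g"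
    by (rule poly_eqI) (simp add: G ab0)
  moreover have lcG: "coeff G (degree g) = 1"
  proof (rule fps_ext)
    fix k show "fps_nth (coeff G (degree g)) k = fps_nth 1 k"
      using ab[of k] g ab0 by (cases "k = 0") (auto simp: G)
  qed
  moreover have "degree G = degree g"
  proof (rule antisym)
    show "degree G \<le> degree g"
      by (rule degree_le) (auto intro!: fps_ext simp: G a_bound)
    show "degree g \<le> degree G" using lcG by (intro le_degree) simp
  qed
  ultimately show ?thesis by (metis)
qed

text \<open>Modulo \<open>X - c\<close> the polynomial \<open>h\<close> is the nonzero constant
  \<open>poly h c\<close>. With \<open>w\<close> its inverse, \<open>(1 - w * h) ^ m\<close> is
  divisible by \<open>(X - c)^m\<close>, while its difference from \<open>1\<close> is divisible by
  \<open>h\<close>.\<close>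

lemma bezout_linear_power:
  fixes h :: "'a::field poly"
  assumes "poly h c \<noteq> 0"
  shows "\<exists>u v. u * [:-c, 1:] ^ m + v * h = 1"
proof -
  have "[:-c, 1:] dvd h - [:poly h c:]" by (simp add: dvd_iff_poly_eq_0)
  then obtain q where "h - [:poly h c:] = [:-c, 1:] * q" by (elim dvdE)
  then have h: "[:poly h c:] = h - [:-c, 1:] * q" by (simp add: algebra_simps)
  define w where "w = [:1 / poly h c:]"
  have "1 = w * [:poly h c:]" using assms by (simp add: w_def one_pCons)
  also have "\<dots> = w * h - [:-c, 1:] * (q * w)" unfolding h by (simp add: algebra_simps)
  finally have 1: "1 - w * h = - ([:-c, 1:] * (q * w))" by (simp add: algebra_simps)
  have "(1 - w * h) ^ m = [:-c, 1:] ^ m * ((- q * w) ^ m)"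
    unfolding 1 by (simp flip: power_mult_distrib)
  moreover have "h dvd 1 - (1 - w * h) ^ m"
  proof (induction m)
    case (Suc m)
    have "1 - (1 - w * h) ^ Suc m = (1 - (1 - w * h) ^ m) + h * (w * (1 - w * h) ^ m)"
      by (simp add: algebra_simps)
    then show ?case using Suc by (metis dvd_add dvd_triv_left)
  qed simp
  then obtain r where "1 - (1 - w * h) ^ m = h * r" by (elim dvdE)
  ultimately have "(- q * w) ^ m * [:-c, 1:] ^ m + r * h = 1" by (simp add: algebra_simps)
  then show ?thesis by blast
qed

section \<open>The two top coefficients under affine substitutions\<close>

lemma coeff_pcompose_linear_top:
  fixes p :: "'a::comm_ring_1 poly"
  assumes "degree p \<le> n"
  shows "coeff (pcompose p [:b, w:]) n = w ^ n * coeff p n"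
  using assms
proof (induction p arbitrary: n)
  case (pCons a p)
  show ?case
  proof (cases n)
    case 0
    with pCons have "p = 0" by (auto split: if_splits)
    with 0 show ?thesis by simp
  next
    case (Suc m)
    have "degree p \<le> m" using pCons.prems Suc pCons.hyps by (auto split: if_splits)
    moreover have "degree (pcompose p [:b, w:]) \<le> degree p * 1"
      by (rule order.trans[OF degree_pcompose_le mult_le_mono2]) simp
    ultimately show ?thesis
      using pCons.IH[of m] Suc
      by (simp add: pcompose_pCons coeff_eq_0 algebra_simps)
  qed
qed simp

text \<open>This serves two purposes: a suitable \<open>b\<close> removes the second coefficient,
  and once it is zero, an affine map that preserves the polynomial has no translation part.\<close>

lemma coeff_pcompose_linear_second:
  fixes p :: "'a::comm_ring_1 poly"
  assumes "degree p \<le> Suc m"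
  shows "coeff (pcompose p [:b, w:]) m = w ^ m * (coeff p m + of_nat (Suc m) * b * coeff p (Suc m))"
  using assms
proof (induction p arbitrary: m)
  case (pCons a p)
  have d: "degree p \<le> m" using pCons.prems pCons.hyps by (auto split: if_splits)
  show ?case
  proof (cases m)
    case 0
    with d obtain c where "p = [:c:]" by (metis degree_eq_zeroE le_zero_eq)
    with 0 show ?thesis by (simp add: pcompose_pCons)
  next
    case (Suc k)
    show ?thesis
      using pCons.IH[of k] d Suc coeff_pcompose_linear_top[OF d, of b w]
      by (simp add: pcompose_pCons algebra_simps)
  qed
qed simp

section \<open>The Newton-Puiseux theorem\<close>

text \<open>For \<open>n > 0\<close> this embeds \<open>K((x))\<close> in \<open>K((t))\<close> with
  \<open>x = t^n\<close>. Adjoining further roots of \<open>x\<close> means enlarging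
  \<open>n\<close>, without leaving the type.\<close>

abbreviation subst_power :: "nat \<Rightarrow> 'a::zero fls \<Rightarrow> 'a fls" where
  "subst_power n \<equiv> (\<lambda>c. fls_compose_power c n)"

lemma subst_power_hom: "n > 0 \<Longrightarrow> inj_idom_hom (subst_power n :: 'a::idom fls \<Rightarrow> _)"
proof unfold_locales
  fix x :: "'a fls" assume n: "n > 0" and x: "subst_power n x = 0"
  show "x = 0"
  proof (rule fls_eqI)
    fix k show "x $$ k = 0 $$ k"
      using arg_cong[OF x, of "\<lambda>c. c $$ (int n * k)"] n by (simp add: fls_nth_compose_power)
  qed
qed auto

lemma subst_power_subst_power:
  assumes "m > 0" "n > 0"
  shows "subst_power n (subst_power m c) = subst_power (m * n) c"
proof (rule fls_eqI)
  fix k :: int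
  show "subst_power n (subst_power m c) $$ k = subst_power (m * n) c $$ k"
  proof (cases "int n dvd k")
    case True
    then obtain l where "k = int n * l" by (elim dvdE)
    with assms show ?thesis by (simp add: fls_nth_compose_power mult.commute[of m n])
  next
    case False
    then have "\<not> int (m * n) dvd k" by (metis dvd_mult_right of_nat_mult)
    with False assms show ?thesis by (simp add: fls_nth_compose_power)
  qed
qed

lemma subst_power_1: "subst_power 1 c = c"
  by (rule fls_eqI) (simp add: fls_nth_compose_power)

lemma map_poly_subst_power_1: "map_poly (subst_power 1) F = F"
  unfolding subst_power_1 by simp

lemma map_poly_subst_power_subst_power:
  fixes F :: "'a::zero fls poly"
  assumes "m > 0" "n > 0"
  shows "map_poly (subst_power n) (map_poly (subst_power m) F) = map_poly (subst_power (m * n)) F"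
  using assms by (intro poly_eqI) (simp add: coeff_map_poly subst_power_subst_power)

lemma fls_subdegree_subst_power:
  assumes "n > 0"
  shows "fls_subdegree (subst_power n c) = int n * fls_subdegree c"
proof (cases "c = 0")
  case False
  show ?thesis
  proof (rule fls_subdegree_eqI)
    show "subst_power n c $$ (int n * fls_subdegree c) \<noteq> 0"
      using False assms by (simp add: fls_nth_compose_power)
  next
    fix k assume k: "k < int n * fls_subdegree c"
    show "subst_power n c $$ k = 0"
    proof (cases "int n dvd k")
      case True
      then obtain l where "k = int n * l" by (elim dvdE)
      with k assms show ?thesis by (simp add: fls_nth_compose_power)
    qed (simp add: assms fls_nth_compose_power)
  qed
qed simp

lemma integral_poly_conv:
  fixes F :: "'a::idom fls poly"
  assumes "\<And>i. fls_subdegree (coeff F i) \<ge> 0"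
  shows "\<exists>G. F = map_poly fps_to_fls G"
proof
  show "F = map_poly fps_to_fls (map_poly fls_regpart F)"
    by (rule poly_eqI) (simp add: coeff_map_poly assms)
qed

text \<open>The slope of an edge of a Newton polygon: \<open>d i\<close> is the order of a
  coefficient and \<open>w i\<close> its horizontal distance from a fixed vertex. The divisibility
  hypothesis keeps the slope integral.\<close>

lemma max_slope:
  fixes w d :: "nat \<Rightarrow> int"
  assumes "finite I" "I \<noteq> {}" "\<And>i. i \<in> I \<Longrightarrow> w i > 0" "\<And>i. i \<in> I \<Longrightarrow> w i dvd d i"
  shows "\<exists>h. (\<forall>i\<in>I. w i * h \<le> d i) \<and> (\<exists>i\<in>I. w i * h = d i)"
proof -
  define h where "h = Min ((\<lambda>i. d i div w i) ` I)"
  have "h \<in> (\<lambda>i. d i div w i) ` I" unfolding h_def using assms by (intro Min_in) auto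
  then obtain i where "i \<in> I" "h = d i div w i" by auto
  then have "w i * h = d i" using assms(4) by simp
  moreover have "w j * h \<le> d j" if "j \<in> I" for j
  proof -
    have "h \<le> d j div w j" unfolding h_def using that assms(1) by (intro Min_le) auto
    then have "w j * h \<le> w j * (d j div w j)" using assms(3)[OF that] by simp
    then show ?thesis using assms(4)[OF that] by simp
  qed
  ultimately show ?thesis using \<open>i \<in> I\<close> by blast
qed

text \<open>
  After a Tschirnhaus transformation and a rescaling, the residue polynomial \<open>P\<close> has vanishing
  second coefficient but is not a pure power of the variable, so it is not a power of a linear
  polynomial, and Hensel's lemma splits off a factor of smaller degree.
\<close>
lemma puiseux_root_exists:
  fixes F :: "'a::{alg_closed_field,field_char_0} fls poly"
  assumes "lead_coeff F = 1" "degree F > 0"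
  shows "\<exists>N z. N > 0 \<and> poly (map_poly (subst_power N) F) z = 0"
  using assms
proof (induction "degree F" arbitrary: F rule: less_induct)
  case (less F)
  define n where "n = degree F"
  have n: "n > 0" using less.prems by (simp add: n_def)
  define a where "a = coeff F (n - 1) / of_nat n"
  define F1 where "F1 = pcompose F [:- a, 1:]"
  have deg1: "degree F1 = n" by (simp add: F1_def n_def degree_pcompose)
  have lc1: "coeff F1 n = 1"
    using coeff_pcompose_linear_top[of F n "-a" 1] less.prems by (simp add: F1_def n_def)
  have sub1: "coeff F1 (n - 1) = 0"
    using coeff_pcompose_linear_second[of F "n - 1" "-a" 1] n less.prems
    by (simp add: F1_def a_def n_def)
  have root1: "\<exists>N z. N > 0 \<and> poly (map_poly (subst_power N) F) z = 0"
    if "N > 0" "poly (map_poly (subst_power N) F1) z = 0" for N z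
  proof -
    interpret N: inj_idom_hom "subst_power N :: 'a fls \<Rightarrow> _" by (rule subst_power_hom) fact
    from that(2) have "poly (map_poly (subst_power N) F) (z - subst_power N a) = 0"
      by (simp add: F1_def N.map_poly_hom_pcompose poly_pcompose N.hom_uminus N.hom_1)
    with that(1) show ?thesis by blast
  qed
  show ?case
  proof (cases "\<forall>i<n. coeff F1 i = 0")
    case True
    then have "poly F1 0 = 0" using n by (simp add: poly_0_coeff_0)
    then show ?thesis using root1[of 1 0] unfolding map_poly_subst_power_1 by simp
  next
    case False
    \<comment> \<open>substituting \<open>t\<^sup>n\<^sup>!\<close> for \<open>t\<close> makes all slopes of the Newton polygon integral\<close>
    define M where "M = (fact n :: nat)"
    have M: "M > 0" by (simp add: M_def)
    interpret M: inj_idom_hom "subst_power M :: 'a fls \<Rightarrow> _" by (rule subst_power_hom) fact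
    define F2 where "F2 = map_poly (subst_power M) F1"
    have F2: "coeff F2 i = subst_power M (coeff F1 i)" for i by (simp add: F2_def)
    define I where "I = {i. i < n \<and> coeff F1 i \<noteq> 0}"
    have "\<exists>h. (\<forall>i\<in>I. int (n - i) * h \<le> fls_subdegree (coeff F2 i)) \<and>
        (\<exists>i\<in>I. int (n - i) * h = fls_subdegree (coeff F2 i))"
    proof (rule max_slope)
      fix i assume "i \<in> I"
      then have "(n - i) dvd M" unfolding M_def I_def by (intro dvd_fact) auto
      then show "int (n - i) dvd fls_subdegree (coeff F2 i)"
        by (simp add: F2 fls_subdegree_subst_power[OF M])
    qed (use False in \<open>auto simp: I_def\<close>)
    then obtain h i0 where h: "\<And>i. i \<in> I \<Longrightarrow> int (n - i) * h \<le> fls_subdegree (coeff F2 i)"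
      and i0: "i0 \<in> I" "int (n - i0) * h = fls_subdegree (coeff F2 i0)" by blast
    \<comment> \<open>The factor \<open>t^(-n h)\<close> restores the leading coefficient
      \<open>1\<close>. By the choice of \<open>h\<close> the other coefficients become integral,
      and the one of index \<open>i0\<close> gets a nonzero constant term.\<close>
    define F3 where "F3 = smult (fls_X_intpow (- (int n * h))) (pcompose F2 [:0, fls_X_intpow h:])"
    have F3: "coeff F3 i = fls_X_intpow (int i * h - int n * h) * coeff F2 i" for i
    proof -
      have "(fls_X_intpow (int i * h - int n * h) :: 'a fls) = fls_X_intpow (- (int n * h)) * fls_X_intpow h ^ i"
        unfolding fls_X_intpow_power fls_X_intpow_times_fls_X_intpow by simp
      then show ?thesis by (simp only: F3_def coeff_pcompose_linear coeff_smult mult.assoc)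
    qed
    have F3_n: "coeff F3 n = 1" by (simp add: F3 F2 lc1 M)
    have sub3: "coeff F3 (n - 1) = 0" using sub1 by (simp add: F3 F2)
    have subdeg: "fls_subdegree (coeff F3 i) = int i * h - int n * h + fls_subdegree (coeff F2 i)"
      if "i \<in> I" for i
    proof -
      have "coeff F2 i \<noteq> 0" using that M by (simp add: I_def F2)
      then show ?thesis unfolding F3 by (subst fls_subdegree_mult_fls_X_intpow) simp_all
    qed
    have int3: "fls_subdegree (coeff F3 i) \<ge> 0" for i
    proof (cases "i \<in> I")
      case True
      with h[of i] have "(int n - int i) * h \<le> fls_subdegree (coeff F2 i)"
        by (simp add: I_def of_nat_diff)
      with subdeg[OF True] show ?thesis by (simp add: algebra_simps)
    next
      case False
      then consider "i = n" | "coeff F1 i = 0"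
        using coeff_eq_0[of F1 i] deg1 by (auto simp: I_def) (metis linorder_neqE_nat)
      then show ?thesis by cases (use F3_n in \<open>simp_all add: F3 F2\<close>)
    qed
    from integral_poly_conv[OF int3] obtain G where G: "F3 = map_poly fps_to_fls G" by blast
    have coeffG: "fps_to_fls (coeff G i) = coeff F3 i" for i by (simp add: G)
    have degG: "degree G = n"
    proof -
      have "degree F3 = n" using deg1 M by (simp add: F3_def degree_pcompose F2_def fls_shift_eq0_iff)
      then show ?thesis by (simp add: G)
    qed
    have lcG: "coeff G n = 1" using coeffG[of n] F3_n by simp
    have subG: "coeff G (n - 1) = 0" using coeffG[of "n-1"] sub3 by simp
    define P where "P = residue_poly G"
    have P_n: "coeff P n = 1" by (simp add: P_def lcG)
    have degP: "degree P = n"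
      using P_n fps_nth_0_hom.degree_map_poly_hom_le[of G] le_degree[of P n] degG by (auto simp: P_def)
    have "coeff P i0 \<noteq> 0"
    proof -
      have "(int n - int i0) * h = fls_subdegree (coeff F2 i0)"
        using i0 by (simp add: I_def of_nat_diff)
      then have "fls_subdegree (coeff F3 i0) = 0"
        using subdeg[OF i0(1)] by (simp add: algebra_simps)
      moreover have "coeff F3 i0 \<noteq> 0" using i0(1) M by (simp add: F3 F2 I_def fls_shift_eq0_iff)
      ultimately have "coeff F3 i0 $$ 0 \<noteq> 0" by (metis nth_fls_subdegree_nonzero)
      then show ?thesis using coeffG[of i0, symmetric] by (simp add: P_def)
    qed
    have subP: "coeff P (n - 1) = 0" using subG by (simp add: P_def)
    obtain c where c: "poly P c = 0" using alg_closed_imp_poly_has_root[of P] degP n by auto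
    have P0: "P \<noteq> 0" using P_n by auto
    define m where "m = order c P"
    obtain k where k: "P = [:- c, 1:] ^ m * k" "\<not> [:- c, 1:] dvd k"
      using order_decomp[OF P0, of c] by (auto simp: m_def)
    have m: "m > 0" using P0 c order_root[of P c] by (simp add: m_def)
    have k0: "k \<noteq> 0" using k(2) by auto
    have degk: "n = m + degree k"
      using degP k0 by (simp add: k(1) degree_mult_eq degree_power_eq)
    have "m \<noteq> n"
    proof
      assume "m = n"
      then have "degree k = 0" using degk by simp
      then obtain e where "k = [:e:]" by (elim degree_eq_zeroE)
      then have P: "P = smult e ([:- c, 1:] ^ n)" using k(1) \<open>m = n\<close> by simp
      have co: "coeff ([:- c, 1:] ^ n) n = 1" using lead_coeff_power[of "[:-c,1:]" n] by (simp add: degree_power_eq)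
      then have e: "e = 1" using P_n by (simp add: P)
      have "[:- c, 1:] ^ n = pcompose (monom 1 n) [:- c, 1:]"
        by (induction n) (simp_all add: monom_Suc pcompose_pCons monom_0)
      then have "coeff P (n - 1) = - of_nat n * c"
        using coeff_pcompose_linear_second[of "monom 1 n :: 'a poly" "n - 1" "-c" 1] n
        by (simp add: P e degree_monom_eq)
      with subP n have "c = 0" by simp
      then have "P = monom 1 n" by (simp add: P e monom_altdef)
      with \<open>coeff P i0 \<noteq> 0\<close> i0(1) show False by (simp add: I_def)
    qed
    with degk have m_less: "m < n" by simp
    have "poly k c \<noteq> 0" using k(2) by (simp add: dvd_iff_poly_eq_0)
    then obtain u v where uv: "u * [:-c, 1:] ^ m + v * k = 1"
      using bezout_linear_power by blast
    have "\<exists>A B. G = A * B \<and> residue_poly A = [:-c, 1:] ^ m \<and> lead_coeff A = 1 \<and> degree A = degree ([:-c, 1:] ^ m)"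
      using lcG degG uv k(1) lead_coeff_power[of "[:-c,1:]" m]
      by (intro hensel_factorization) (auto simp: P_def)
    then obtain A B where AB: "G = A * B" "lead_coeff A = 1" "degree A = m"
      by (auto simp: degree_power_eq)
    define A' where "A' = map_poly fps_to_fls A"
    have "\<exists>N z. N > 0 \<and> poly (map_poly (subst_power N) A') z = 0"
      using AB m m_less by (intro less.hyps) (auto simp: A'_def n_def)
    then obtain N z where N: "N > 0" and z: "poly (map_poly (subst_power N) A') z = 0" by blast
    interpret N: inj_idom_hom "subst_power N :: 'a fls \<Rightarrow> _" by (rule subst_power_hom) fact
    have "A' dvd F3" by (simp add: A'_def G AB(1) fps_to_fls_hom.map_poly_hom_mult)
    then have "map_poly (subst_power N) A' dvd map_poly (subst_power N) F3" by (rule N.map_poly_hom_dvd)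
    then have "poly (map_poly (subst_power N) F3) z = 0" using z by (auto elim!: dvdE)
    then have "poly (map_poly (subst_power N) F2) (subst_power N (fls_X_intpow h) * z) = 0"
      using N by (simp add: F3_def N.map_poly_hom_smult N.map_poly_hom_pcompose poly_pcompose N.hom_1 mult.commute fls_shift_eq0_iff)
    then show ?thesis
      using N M root1[of "M * N"] by (simp add: F2_def map_poly_subst_power_subst_power)
  qed
qed

text \<open>Splitting off one root at a time may need a new substitution at each step, so the
  exponents are multiplied and the roots found earlier are carried along by
  \<open>subst_power M\<close>.\<close>

lemma puiseux_splits:
  fixes F :: "'a::{alg_closed_field,field_char_0} fls poly"
  assumes "lead_coeff F = 1"
  shows "\<exists>N A. N > 0 \<and> map_poly (subst_power N) F = (\<Prod>z\<in>#A. [:- z, 1:])"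
  using assms
proof (induction "degree F" arbitrary: F rule: less_induct)
  case (less F)
  show ?case
  proof (cases "degree F = 0")
    case True
    with less.prems have "F = 1" by (metis degree_eq_zeroE coeff_pCons_0 one_pCons)
    then show ?thesis by (intro exI[of _ 1] exI[of _ "{#}"]) auto
  next
    case False
    then obtain N z where N: "N > 0" and z: "poly (map_poly (subst_power N) F) z = 0"
      using puiseux_root_exists[OF less.prems] by auto
    interpret N: inj_idom_hom "subst_power N :: 'a fls \<Rightarrow> _" by (rule subst_power_hom) fact
    from z obtain Q where Q: "map_poly (subst_power N) F = [:- z, 1:] * Q"
      by (metis dvdE poly_eq_0_iff_dvd)
    have lcF: "lead_coeff (map_poly (subst_power N) F) = 1" using less.prems N by simp
    then have lcQ: "lead_coeff Q = 1" unfolding Q by (simp add: lead_coeff_mult del: mult_pCons_left)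
    then have "Q \<noteq> 0" by auto
    then have "degree F = Suc (degree Q)"
      using arg_cong[OF Q, of degree] by (simp add: degree_mult_eq del: mult_pCons_left)
    then obtain M A where M: "M > 0" and A: "map_poly (subst_power M) Q = (\<Prod>z\<in>#A. [:- z, 1:])"
      using less.hyps[of Q] lcQ by auto
    interpret M: inj_idom_hom "subst_power M :: 'a fls \<Rightarrow> _" by (rule subst_power_hom) fact
    have "map_poly (subst_power (N * M)) F = map_poly (subst_power M) ([:- z, 1:] * Q)"
      by (simp only: Q[symmetric] map_poly_subst_power_subst_power[OF N M])
    also have "\<dots> = [:- subst_power M z, 1:] * (\<Prod>z\<in>#A. [:- z, 1:])"
      by (simp only: M.map_poly_hom_mult A) (use M in \<open>simp add: M.hom_1 M.hom_uminus\<close>)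
    also have "\<dots> = (\<Prod>z\<in>#add_mset (subst_power M z) A. [:- z, 1:])"
      by (simp only: image_mset_add_mset prod_mset.add_mset)
    finally show ?thesis using N M
      by (intro exI[of _ "N * M"] exI[of _ "add_mset (subst_power M z) A"] conjI) (simp_all only: nat_0_less_mult_iff)
  qed
qed

section \<open>Galois conjugation\<close>

lemma irreducible_poly_degree_pos:
  fixes H :: "'a::field poly"
  assumes "irreducible H"
  shows "degree H > 0"
proof (rule ccontr)
  assume "\<not> degree H > 0"
  with assms show False
    by (metis is_unit_iff_degree irreducible_def neq0_conv)
qed

lemma monic_irreducible_dvd_imp_eq:
  fixes m H :: "'a::field poly"
  assumes "irreducible m" "irreducible H" "lead_coeff m = 1" "lead_coeff H = 1" "m dvd H"
  shows "m = H"
proof -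
  from assms(5) obtain k where k: "H = m * k" by (elim dvdE)
  with assms(1,2) have "k dvd 1" by (auto simp: irreducible_def)
  then have "degree k = 0" by (metis is_unit_iff_degree dvd_0_left zero_neq_one)
  then obtain c where "k = [:c:]" by (elim degree_eq_zeroE)
  moreover have "lead_coeff k = 1" using assms(3,4) k by (simp add: lead_coeff_mult)
  ultimately show ?thesis using k by simp
qed

text \<open>The usual argument with a polynomial of least degree. \<open>K((x))\<close> is not a
  subset of \<open>K((t))\<close> here, so the inclusion appears as \<open>hom\<close>, later
  instantiated by \<open>subst_power N\<close>.\<close>

lemma minimal_polynomial_exists:
  fixes hom :: "'a::field \<Rightarrow> 'b::field"
  assumes "idom_hom hom" and F: "F \<noteq> 0" "poly (map_poly hom F) z = 0"
  shows "\<exists>m. lead_coeff m = 1 \<and> irreducible m \<and> (\<forall>p. poly (map_poly hom p) z = 0 \<longleftrightarrow> m dvd p)"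
proof -
  interpret idom_hom hom by fact
  define P where "P = (\<lambda>p. p \<noteq> 0 \<and> poly (map_poly hom p) z = 0)"
  define q where "q = (ARG_MIN degree p. P p)"
  have q: "P q" and min: "\<And>p. P p \<Longrightarrow> degree q \<le> degree p"
    using arg_min_natI[of P F degree] arg_min_nat_le[of P _ degree] F by (auto simp: P_def q_def)
  define m where "m = smult (1 / lead_coeff q) q"
  have m1: "lead_coeff m = 1" using q by (simp add: m_def P_def)
  have mz: "poly (map_poly hom m) z = 0"
    using q by (simp add: m_def P_def map_poly_hom_smult)
  have degm: "degree m = degree q" using q by (simp add: m_def P_def)
  have m0: "m \<noteq> 0" using m1 by auto
  have dvd: "poly (map_poly hom p) z = 0 \<longleftrightarrow> m dvd p" for p
  proof
    assume "m dvd p"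
    then show "poly (map_poly hom p) z = 0"
      using mz by (auto simp: map_poly_hom_mult elim!: dvdE)
  next
    assume p: "poly (map_poly hom p) z = 0"
    have "map_poly hom p = map_poly hom m * map_poly hom (p div m) + map_poly hom (p mod m)"
      by (simp flip: map_poly_hom_mult map_poly_hom_add)
    then have "poly (map_poly hom (p mod m)) z = 0" using p mz by simp
    then have "p mod m = 0"
      using degree_mod_less[OF m0, of p] min[of "p mod m"] degm by (force simp: P_def)
    then show "m dvd p" by (simp add: mod_eq_0_iff_dvd)
  qed
  have "\<not> m dvd 1" using dvd[of 1] by simp
  moreover have "a dvd 1 \<or> b dvd 1" if ab: "m = a * b" for a b
  proof -
    have unit: "b' dvd 1" if "m = a' * b'" "poly (map_poly hom a') z = 0" for a' b'
    proof -
      have "a' \<noteq> 0" "b' \<noteq> 0" using that(1) m0 by auto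
      with that degm min[of a'] have "degree b' = 0" by (auto simp: P_def degree_mult_eq)
      with \<open>b' \<noteq> 0\<close> show ?thesis by (simp add: is_unit_iff_degree)
    qed
    have "poly (map_poly hom a) z = 0 \<or> poly (map_poly hom b) z = 0"
      using mz by (simp add: ab map_poly_hom_mult)
    then show ?thesis using unit[of a b] unit[of b a] ab by (auto simp: mult.commute)
  qed
  ultimately have "irreducible m" using m0 by (auto simp: irreducible_def)
  with m1 dvd show ?thesis by blast
qed

text \<open>The substitution \<open>t\<close> to \<open>\<zeta> t\<close>. For
  \<open>\<zeta>^N = 1\<close> it fixes \<open>K((t^N))\<close>, and these maps form the Galois
  group of \<open>K((t))\<close> over that field.\<close>

lift_definition fls_scale :: "'a::field \<Rightarrow> 'a fls \<Rightarrow> 'a fls" is "\<lambda>\<zeta> c n. \<zeta> powi n * c n"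
  by (auto elim: eventually_mono)

lemma fls_scale_nth [simp]: "fls_scale \<zeta> c $$ n = \<zeta> powi n * c $$ n"
  by transfer simp

lemma fls_scale_1 [simp]: "fls_scale 1 c = c"
  by (rule fls_eqI) simp

lemma fls_scale_fls_scale: "fls_scale \<zeta> (fls_scale \<xi> c) = fls_scale (\<zeta> * \<xi>) c"
  by (rule fls_eqI) (simp add: power_int_mult_distrib)

definition fps_scale :: "'a::field \<Rightarrow> 'a fps \<Rightarrow> 'a fps" where
  "fps_scale \<zeta> c = Abs_fps (\<lambda>n. \<zeta> ^ n * fps_nth c n)"

lemma fps_scale_nth [simp]: "fps_nth (fps_scale \<zeta> c) n = \<zeta> ^ n * fps_nth c n"
  by (simp add: fps_scale_def)

lemma fls_scale_fps_to_fls: "fls_scale \<zeta> (fps_to_fls c) = fps_to_fls (fps_scale \<zeta> c)"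
  by (rule fls_eqI) (simp add: power_int_def)

lemma fls_scale_X_intpow: "fls_scale \<zeta> (fls_X_intpow h) = fls_const (\<zeta> powi h) * fls_X_intpow h"
  by (rule fls_eqI) (simp)

lemma fls_scale_hom:
  assumes "\<zeta> \<noteq> 0"
  shows "inj_idom_hom (fls_scale \<zeta>)"
proof unfold_locales
  have sub: "fls_subdegree (fls_scale \<zeta> c) = fls_subdegree c" for c
  proof (cases "c = 0")
    case True
    then have "fls_scale \<zeta> c = 0" by (intro fls_eqI) simp
    with True show ?thesis by simp
  next
    case False
    with assms show ?thesis by (intro fls_subdegree_eqI) auto
  qed
  fix x y :: "'a fls"
  show "fls_scale \<zeta> (x + y) = fls_scale \<zeta> x + fls_scale \<zeta> y"
    by (rule fls_eqI) (simp add: algebra_simps)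
  show "fls_scale \<zeta> (x * y) = fls_scale \<zeta> x * fls_scale \<zeta> y"
  proof (rule fls_eqI)
    fix n
    have "\<zeta> powi n * (x $$ i * y $$ (n - i)) = (\<zeta> powi i * x $$ i) * (\<zeta> powi (n - i) * y $$ (n - i))" for i
      using power_int_add[of \<zeta> i "n - i"] assms by simp
    then show "fls_scale \<zeta> (x * y) $$ n = (fls_scale \<zeta> x * fls_scale \<zeta> y) $$ n"
      by (simp only: fls_scale_nth fls_times_nth(2) sub sum_distrib_left)
  qed
  show "fls_scale \<zeta> 1 = 1" by (rule fls_eqI) simp
  show "x = 0" if "fls_scale \<zeta> x = 0"
  proof (rule fls_eqI)
    fix n show "x $$ n = 0 $$ n"
      using arg_cong[OF that, of "\<lambda>c. c $$ n"] assms by simp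
  qed
qed

lemma fls_scale_subst_power:
  assumes "n > 0" "\<zeta> ^ n = 1"
  shows "fls_scale \<zeta> (subst_power n c) = subst_power n c"
proof (rule fls_eqI)
  fix k
  show "fls_scale \<zeta> (subst_power n c) $$ k = subst_power n c $$ k"
  proof (cases "int n dvd k")
    case True
    then obtain l where "k = int n * l" by (elim dvdE)
    then have "\<zeta> powi k = 1" using assms by (simp add: power_int_mult)
    then show ?thesis by simp
  qed (use assms in \<open>simp add: fls_nth_compose_power\<close>)
qed

section \<open>Roots with multiplicity, roots of unity and Galois descent\<close>

lemma proots_prod_linear:
  "proots (\<Prod>x\<in>#A. [:- x, 1 :: 'a::idom:]) = A"
proof (induction A)
  case (add x A)
  have "(\<Prod>x\<in>#A. [:- x, 1 :: 'a:]) \<noteq> 0" by (auto simp: prod_mset_zero_iff)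
  then have "proots ([:- x, 1:] * (\<Prod>x\<in>#A. [:- x, 1:])) = proots [:- x, 1:] + proots (\<Prod>x\<in>#A. [:- x, 1:])"
    by (intro proots_mult) simp_all
  then show ?case using add by (simp del: mult_pCons_left)
qed simp

lemma sum_order_eq_degree:
  fixes p :: "'a::alg_closed_field poly"
  assumes "p \<noteq> 0"
  shows "(\<Sum>x | poly p x = 0. order x p) = degree p"
proof -
  obtain A where A: "size A = degree p" "p = smult (lead_coeff p) (\<Prod>x\<in>#A. [:- x, 1:])"
    using alg_closed_imp_factorization[OF assms] by blast
  have "proots p = proots (\<Prod>x\<in>#A. [:- x, 1:])" using assms by (subst A(2)) simp
  then have "degree p = size (proots p)" using A(1) by (simp add: proots_prod_linear)
  also have "\<dots> = (\<Sum>x | poly p x = 0. order x p)"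
    using assms by (simp add: size_multiset_overloaded_eq)
  finally show ?thesis by simp
qed

text \<open>The roots of \<open>X^n - 1\<close> are nonzero, and the derivative
  \<open>n X^(n-1)\<close> does not vanish there, so all of them are simple.\<close>

lemma card_roots_of_unity_alg_closed:
  assumes "n > 0"
  shows "card {\<zeta> :: 'a::{alg_closed_field,field_char_0}. \<zeta> ^ n = 1} = n"
proof -
  define p :: "'a poly" where "p = monom 1 n - 1"
  have degp: "degree p = n"
  proof (rule antisym)
    show "degree p \<le> n" unfolding p_def by (intro degree_diff_le) (simp_all add: degree_monom_le)
    show "n \<le> degree p" using assms by (intro le_degree) (simp add: p_def)
  qed
  have p0: "p \<noteq> 0" using degp assms by auto
  have eq: "{\<zeta>. \<zeta> ^ n = 1} = {\<zeta>. poly p \<zeta> = 0}" by (simp add: p_def poly_monom)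
  have "order x p = 1" if "poly p x = 0" for x
  proof -
    have "x ^ n = 1" using that by (simp add: p_def poly_monom)
    then have "x \<noteq> 0" using assms by (metis power_0_left less_irrefl zero_neq_one)
    then have "poly (pderiv p) x \<noteq> 0" using assms
      by (simp add: p_def pderiv_diff pderiv_monom poly_monom pderiv_1)
    then show ?thesis using order_pderiv[OF p0 that] order_0I by simp
  qed
  then show ?thesis
    using sum_order_eq_degree[OF p0] degp by (simp add: eq)
qed

text \<open>A nonzero coefficient at \<open>k\<close> forces \<open>\<zeta>^k = 1\<close> for every
  \<open>n\<close>-th root of unity. If \<open>r = k mod n\<close> were positive, all
  \<open>n\<close> of them would be roots of \<open>X^r - 1\<close>, which has only
  \<open>r < n\<close> roots. Counting replaces the choice of a primitive root of unity.\<close>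

lemma fls_scale_fixed_imp_subst_power:
  fixes c :: "'a::{alg_closed_field,field_char_0} fls"
  assumes n: "n > 0" and fixed: "\<And>\<zeta>. \<zeta> ^ n = 1 \<Longrightarrow> fls_scale \<zeta> c = c"
  shows "\<exists>c'. c = subst_power n c'"
proof -
  have zero: "c $$ k = 0" if "\<not> int n dvd k" for k
  proof (rule ccontr)
    assume ck: "c $$ k \<noteq> 0"
    define r where "r = nat (k mod int n)"
    have r: "0 < r" "r < n" and k: "k = int n * (k div int n) + int r"
      using that n by (auto simp: r_def dvd_eq_mod_eq_0 nat_less_iff order.not_eq_order_implies_strict)
    have "{\<zeta> :: 'a. \<zeta> ^ n = 1} \<subseteq> {\<zeta>. \<zeta> ^ r = 1}"
    proof safe
      fix \<zeta> :: 'a assume z: "\<zeta> ^ n = 1"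
      then have z0: "\<zeta> \<noteq> 0" using n by (metis power_0_left less_irrefl zero_neq_one)
      have "\<zeta> powi k * c $$ k = c $$ k" using arg_cong[OF fixed[OF z], of "\<lambda>c. c $$ k"] by simp
      then have "\<zeta> powi k = 1" using ck by simp
      then show "\<zeta> ^ r = 1" using z z0 by (subst (asm) k) (simp add: power_int_add power_int_mult)
    qed
    moreover have "finite {\<zeta> :: 'a. \<zeta> ^ r = 1}"
      using card_roots_of_unity_alg_closed[of r, where 'a='a] r(1) by (intro card_ge_0_finite) simp
    ultimately have "card {\<zeta> :: 'a. \<zeta> ^ n = 1} \<le> card {\<zeta> :: 'a. \<zeta> ^ r = 1}"
      by (rule card_mono[rotated])
    then show False using r n by (simp add: card_roots_of_unity_alg_closed)
  qed
  define c' where "c' = Abs_fls (\<lambda>k. c $$ (int n * k))"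
  have c': "c' $$ k = c $$ (int n * k)" for k
    unfolding c'_def
  proof (rule nth_Abs_fls_lower_bound, intro allI impI)
    \<comment> \<open>The minimum with \<open>0\<close> is there because \<open>n k \<le> k\<close>
      needs \<open>k \<le> 0\<close>.\<close>
    fix k assume k: "k < min 0 (fls_subdegree c)"
    then have "int n * k \<le> 1 * k" using n by (intro mult_right_mono_neg) auto
    moreover have "k < fls_subdegree c" using k by simp
    ultimately have "int n * k < fls_subdegree c" by linarith
    then show "c $$ (int n * k) = 0" by simp
  qed
  have "c = subst_power n c'"
  proof (rule fls_eqI)
    fix k show "c $$ k = subst_power n c' $$ k"
      using zero[of k] n by (auto simp: fls_nth_compose_power c')
  qed
  then show ?thesis by blast
qed

text \<open>The product of the linear factors over the orbit \<open>Y\<close> of \<open>y\<close> is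
  Galois invariant, so it descends to a polynomial \<open>G0\<close> over \<open>K((x))\<close> with
  root \<open>y\<close>. Then \<open>m\<close> divides \<open>G0\<close>, whose roots are only the
  conjugates of \<open>y\<close>.\<close>

lemma roots_of_irreducible_conjugate:
  fixes m :: "'a::{alg_closed_field,field_char_0} fls poly"
  assumes N: "N > 0"
    and m: "\<And>p. poly (map_poly (subst_power N) p) y = 0 \<Longrightarrow> m dvd p"
    and y': "poly (map_poly (subst_power N) m) y' = 0"
  shows "\<exists>\<zeta>. \<zeta> ^ N = 1 \<and> y' = fls_scale \<zeta> y"
proof -
  interpret N: inj_idom_hom "subst_power N :: 'a fls \<Rightarrow> _" by (rule subst_power_hom) fact
  define U where "U = {\<zeta> :: 'a. \<zeta> ^ N = 1}"
  have finU: "finite U" unfolding U_def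
    using card_roots_of_unity_alg_closed[OF N, where 'a='a] N by (intro card_ge_0_finite) simp
  define Y where "Y = (\<lambda>\<zeta>. fls_scale \<zeta> y) ` U"
  have finY: "finite Y" using finU by (simp add: Y_def)
  define G where "G = (\<Prod>w\<in>Y. [:- w, 1:])"
  have inv: "map_poly (fls_scale \<zeta>) G = G" if z: "\<zeta> ^ N = 1" for \<zeta>
  proof -
    have z0: "\<zeta> \<noteq> 0" using z N by (metis power_0_left less_irrefl zero_neq_one)
    interpret S: inj_idom_hom "fls_scale \<zeta>" by (rule fls_scale_hom) fact
    have inj: "inj_on (fls_scale \<zeta>) Y" by (rule inj_onI) (simp add: S.hom_eq_iff)
    have "fls_scale \<zeta> ` Y \<subseteq> Y"
      using z by (auto simp: Y_def U_def fls_scale_fls_scale power_mult_distrib intro!: image_eqI)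
    then have "fls_scale \<zeta> ` Y = Y"
      using finY inj by (intro card_subset_eq) (auto simp: card_image)
    then have "G = (\<Prod>w\<in>fls_scale \<zeta> ` Y. [:- w, 1:])" by (simp add: G_def)
    also have "\<dots> = (\<Prod>w\<in>Y. map_poly (fls_scale \<zeta>) [:- w, 1:])"
      using inj by (subst prod.reindex) (simp_all add: S.hom_uminus S.hom_1)
    also have "\<dots> = map_poly (fls_scale \<zeta>) G"
      unfolding G_def using finY by induction (simp_all only: prod.empty prod.insert S.map_poly_hom_1 S.map_poly_hom_mult not_False_eq_True if_False)
    finally show ?thesis by simp
  qed
  have "\<exists>c'. coeff G i = subst_power N c'" for i
  proof (rule fls_scale_fixed_imp_subst_power[OF N])
    fix \<zeta> :: 'a assume z: "\<zeta> ^ N = 1"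
    then have "\<zeta> \<noteq> 0" using N by (metis power_0_left less_irrefl zero_neq_one)
    then interpret S: inj_idom_hom "fls_scale \<zeta>" by (rule fls_scale_hom)
    show "fls_scale \<zeta> (coeff G i) = coeff G i"
      using arg_cong[OF inv[OF z], of "\<lambda>p. coeff p i"] by simp
  qed
  then obtain c where c: "\<And>i. coeff G i = subst_power N (c i)" by metis
  define G0 where "G0 = (\<Sum>i\<le>degree G. monom (c i) i)"
  have G0: "G = map_poly (subst_power N) G0"
  proof (rule poly_eqI)
    fix i
    show "coeff G i = coeff (map_poly (subst_power N) G0) i"
      using c[of i] coeff_eq_0[of G i]
      by (auto simp: G0_def coeff_sum not_le if_distrib cong: if_cong)
  qed
  have "y \<in> Y" using image_eqI[of y "\<lambda>\<zeta>. fls_scale \<zeta> y" 1 U] by (simp add: Y_def U_def)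
  then have "poly G y = 0" using finY by (simp add: G_def poly_prod prod_zero_iff)
  with G0 have "m dvd G0" using m by simp
  then have "poly G y' = 0"
    using N.map_poly_hom_dvd y' G0 by (metis dvdE mult_zero_left poly_mult)
  then have "y' \<in> Y" using finY by (auto simp: G_def poly_prod)
  then show ?thesis by (auto simp: Y_def U_def)
qed

section \<open>Critical values of polynomials with symmetries\<close>

text \<open>Passing to the derivative lowers the multiplicity of each root by one. Of the
  \<open>degree Q - 1\<close> zeros of the derivative, the roots of \<open>Q\<close> therefore use
  up \<open>degree Q\<close> minus their number, and what is left bounds the other critical
  points.\<close>

lemma card_critical_points_less_card_roots:
  fixes Q :: "'a::{alg_closed_field,field_char_0} poly"
  assumes "degree Q > 0"
  shows "card {z. poly (pderiv Q) z = 0 \<and> poly Q z \<noteq> 0} < card {z. poly Q z = 0}"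
proof -
  have Q0: "Q \<noteq> 0" using assms by auto
  then have Q'0: "pderiv Q \<noteq> 0" using assms by (simp add: pderiv_eq_0_iff)
  define R where "R = {z. poly Q z = 0}"
  define C where "C = {z. poly (pderiv Q) z = 0 \<and> poly Q z \<noteq> 0}"
  define Z where "Z = {z. poly (pderiv Q) z = 0}"
  have fin: "finite R" "finite Z" "finite C"
    using poly_roots_finite[OF Q0] poly_roots_finite[OF Q'0]
    by (auto simp: R_def Z_def C_def intro: finite_subset)
  have "degree Q = (\<Sum>z\<in>R. order z Q)" using sum_order_eq_degree[OF Q0] by (simp add: R_def)
  also have "\<dots> = (\<Sum>z\<in>R. order z (pderiv Q) + 1)"
    by (intro sum.cong) (simp_all add: R_def order_pderiv[OF Q0])
  finally have 1: "degree Q = (\<Sum>z\<in>R. order z (pderiv Q)) + card R" unfolding sum.distrib by simp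
  have "card C = (\<Sum>z\<in>C. 1)" by simp
  also have "\<dots> \<le> (\<Sum>z\<in>C. order z (pderiv Q))"
    using Q'0 by (intro sum_mono) (simp add: C_def order_gt_0_iff Suc_le_eq)
  finally have "(\<Sum>z\<in>R. order z (pderiv Q)) + card C \<le>
      (\<Sum>z\<in>R. order z (pderiv Q)) + (\<Sum>z\<in>C. order z (pderiv Q))" by simp
  also have "\<dots> = (\<Sum>z\<in>R \<union> C. order z (pderiv Q))"
    using fin by (intro sum.union_disjoint[symmetric]) (auto simp: R_def C_def)
  also have "\<dots> = (\<Sum>z\<in>Z. order z (pderiv Q))"
    using fin by (intro sum.mono_neutral_right) (auto simp: R_def C_def Z_def order_0I)
  also have "\<dots> \<le> degree (pderiv Q)" using sum_order_le_degree[OF Q'0] by (simp add: Z_def)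
  also have "\<dots> < degree Q" using assms by (simp add: degree_pderiv)
  finally show ?thesis using 1 by (simp add: R_def C_def)
qed

lemma card_image_le_card_image:
  assumes "finite (f ` A)" "\<And>x y. x \<in> A \<Longrightarrow> y \<in> A \<Longrightarrow> f x = f y \<Longrightarrow> g x = g y"
  shows "card (g ` A) \<le> card (f ` A)"
proof -
  have "g ` A \<subseteq> (\<lambda>v. g (inv_into A f v)) ` f ` A"
  proof (rule image_subsetI)
    fix x assume x: "x \<in> A"
    then have "inv_into A f (f x) \<in> A" "f (inv_into A f (f x)) = f x"
      by (auto intro: inv_into_into f_inv_into_f)
    with x assms(2)[of x "inv_into A f (f x)"] show "g x \<in> (\<lambda>v. g (inv_into A f v)) ` f ` A"
      by auto
  qed
  then have "card (g ` A) \<le> card ((\<lambda>v. g (inv_into A f v)) ` f ` A)"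
    using assms(1) by (intro card_mono) auto
  also have "\<dots> \<le> card (f ` A)" using assms(1) by (rule card_image_le)
  finally show ?thesis .
qed

text \<open>
  Translating the barycentre of the roots to \<open>0\<close>, every affine symmetry of the polynomial becomes a
  multiplication by some \<open>\<omega>\<close>, and the polynomial takes the form \<open>Q(z\<^sup>e)\<close> with \<open>\<omega>\<^sup>e = 1\<close> for all these \<open>\<omega>\<close>.
  Its critical values are then those of \<open>Q\<close> and \<open>Q(0)\<close>.
\<close>
lemma card_critical_values_le_card_root_classes:
  fixes P :: "'a::{alg_closed_field,field_char_0} poly"
  assumes degP: "degree P > 0"
    and \<phi>: "\<And>s s'. poly P s = 0 \<Longrightarrow> poly P s' = 0 \<Longrightarrow> \<phi> s = \<phi> s' \<Longrightarrow>
      \<exists>\<omega> b. \<omega> \<noteq> 0 \<and> pcompose P [:b, \<omega>:] = P \<and> s' = b + \<omega> * s"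
  shows "card (poly P ` {z. poly (pderiv P) z = 0 \<and> poly P z \<noteq> 0}) \<le> card (\<phi> ` {s. poly P s = 0})"
proof -
  obtain m where n: "degree P = Suc m" using degP by (metis gr0_implies_Suc)
  \<comment> \<open>The barycentre of the roots of \<open>P\<close>, read off from the two top
    coefficients.\<close>
  define c where "c = - coeff P m / (of_nat (Suc m) * lead_coeff P)"
  define R where "R = pcompose P [:c, 1:]"
  have P0: "P \<noteq> 0" using degP by auto
  have degR: "degree R = Suc m" by (simp add: R_def degree_pcompose n)
  then have lcR: "coeff R (Suc m) \<noteq> 0" by (metis leading_coeff_0_iff degree_0 nat.distinct(1))
  have subR: "coeff R m = 0"
  proof -
    have "of_nat (Suc m) * c * coeff P (Suc m) = - coeff P m"
      using P0 n by (simp add: c_def leading_coeff_neq_0 del: of_nat_Suc) (metis leading_coeff_0_iff)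
    then show ?thesis
      unfolding R_def using coeff_pcompose_linear_second[of P m c 1] n by (simp del: of_nat_Suc)
  qed
  \<comment> \<open>These are the \<open>\<omega>\<close> with \<open>R(\<omega> z) = R(z)\<close>,
    and \<open>e\<close> is the exponent of this group. Every \<open>i\<close> in the support of
    \<open>R\<close> satisfies \<open>\<omega>^i = 1\<close> throughout the group, so division with
    remainder and minimality give that \<open>e\<close> divides \<open>i\<close>.\<close>
  define \<Omega> where "\<Omega> = {\<omega> :: 'a. \<forall>i. coeff R i \<noteq> 0 \<longrightarrow> \<omega> ^ i = 1}"
  define good where "good = (\<lambda>e. e > 0 \<and> (\<forall>\<omega>\<in>\<Omega>. \<omega> ^ e = 1))"
  define e where "e = (LEAST e. good e)"
  have good_n: "good (Suc m)" using lcR by (auto simp: good_def \<Omega>_def)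
  then have "good e" unfolding e_def by (rule LeastI)
  then have e: "e > 0" "\<And>\<omega>. \<omega> \<in> \<Omega> \<Longrightarrow> \<omega> ^ e = 1" by (auto simp: good_def)
  have dvd: "e dvd i" if "coeff R i \<noteq> 0" for i
  proof (rule ccontr)
    assume "\<not> e dvd i"
    moreover have "\<omega> ^ (i mod e) = 1" if \<omega>: "\<omega> \<in> \<Omega>" for \<omega>
    proof -
      have "\<omega> ^ i = (\<omega> ^ e) ^ (i div e) * \<omega> ^ (i mod e)"
        by (metis mult_div_mod_eq power_add power_mult)
      moreover have "\<omega> ^ i = 1" using \<omega> \<open>coeff R i \<noteq> 0\<close> by (simp add: \<Omega>_def)
      ultimately show ?thesis using e(2)[OF \<omega>] by simp
    qed
    ultimately have "good (i mod e)" by (auto simp: good_def dvd_eq_mod_eq_0)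
    then have "e \<le> i mod e" unfolding e_def by (rule Least_le)
    with mod_less_divisor[OF e(1), of i] show False by simp
  qed
  define Q where "Q = (\<Sum>j\<le>Suc m. monom (coeff R (e * j)) j)"
  have polyQ: "poly Q (z ^ e) = poly R z" for z
  proof -
    have "poly R z = (\<Sum>i\<le>Suc m. coeff R i * z ^ i)" by (simp add: poly_altdef degR)
    also have "\<dots> = (\<Sum>i\<in>(*) e ` {..Suc m}. coeff R i * z ^ i)"
    proof (rule sum.mono_neutral_cong)
      fix i assume i: "i \<in> {..Suc m} - (*) e ` {..Suc m}"
      have "\<not> e dvd i"
      proof
        assume "e dvd i"
        then obtain k where "i = e * k" by (elim dvdE)
        moreover have "k \<le> e * k" using e(1) by simp
        moreover have "i \<le> Suc m" using i by simp
        ultimately have "k \<le> Suc m" using \<open>i = e * k\<close> by linarith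
        then have "k \<in> {..Suc m}" by simp
        with i \<open>i = e * k\<close> show False by blast
      qed
      then show "coeff R i * z ^ i = 0" using dvd by auto
    next
      fix i assume "i \<in> (*) e ` {..Suc m} - {..Suc m}"
      then show "coeff R i * z ^ i = 0" using degR by (simp add: coeff_eq_0)
    qed simp_all
    also have "\<dots> = (\<Sum>j\<le>Suc m. coeff R (e * j) * z ^ (e * j))"
      using e(1) by (subst sum.reindex) (auto simp: inj_on_def)
    also have "\<dots> = poly Q (z ^ e)" by (simp only: Q_def poly_sum poly_monom power_mult)
    finally show ?thesis by simp
  qed
  have RQ: "R = pcompose Q (monom 1 e)"
    by (simp add: poly_eq_poly_eq_iff[symmetric] fun_eq_iff poly_pcompose poly_monom polyQ)
  then have "degree R = degree Q * e" by (simp add: degree_pcompose degree_monom_eq)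
  then have degQ: "degree Q > 0" using degR by (metis mult_0 neq0_conv nat.distinct(1))
  define C where "C = {z. poly (pderiv Q) z = 0 \<and> poly Q z \<noteq> 0}"
  have finC: "finite C"
    using poly_roots_finite[of "pderiv Q"] degQ
    by (auto simp: C_def pderiv_eq_0_iff intro: finite_subset)
  have "poly P ` {z. poly (pderiv P) z = 0 \<and> poly P z \<noteq> 0} \<subseteq> insert (poly Q 0) (poly Q ` C)"
  proof safe
    fix z assume z: "poly (pderiv P) z = 0" "poly P z \<noteq> 0" "poly P z \<notin> poly Q ` C"
    define w where "w = z - c"
    have Pz: "poly P z = poly Q (w ^ e)" by (simp add: polyQ R_def poly_pcompose w_def)
    have "poly (pderiv R) w = 0"
      using z(1) by (simp add: R_def pderiv_pcompose poly_pcompose w_def)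
    then have "poly (pderiv Q) (w ^ e) = 0 \<or> w ^ (e - 1) = 0"
      using e(1) by (simp add: RQ pderiv_pcompose poly_pcompose poly_monom pderiv_monom)
    moreover have "poly (pderiv Q) (w ^ e) \<noteq> 0" using z by (auto simp: Pz C_def)
    ultimately have "w = 0" by (cases "e = 1") auto
    then show "poly P z = poly Q 0" using Pz e(1) by (simp add: power_0_left)
  qed
  then have "card (poly P ` {z. poly (pderiv P) z = 0 \<and> poly P z \<noteq> 0}) \<le> card (insert (poly Q 0) (poly Q ` C))"
    using finC by (intro card_mono) auto
  \<comment> \<open>The possible extra value \<open>Q(0)\<close> is absorbed by the strictness of
    \<open>card_critical_points_less_card_roots\<close>.\<close>
  also have "\<dots> \<le> Suc (card C)"
    using card_insert_le_m1[of "Suc (card C)" "poly Q ` C" "poly Q 0"] card_image_le[OF finC, of "poly Q"] by simp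
  also have "\<dots> \<le> card {z. poly Q z = 0}"
    using card_critical_points_less_card_roots[OF degQ] by (simp add: C_def)
  also have "{z. poly Q z = 0} = (\<lambda>s. (s - c) ^ e) ` {s. poly P s = 0}"
  proof safe
    fix z assume z: "poly Q z = 0"
    obtain w where w: "w ^ e = z" using nth_root_exists[OF e(1)] by blast
    have "poly P (w + c) = 0" using z polyQ[of w] by (simp add: R_def poly_pcompose w add.commute)
    with w show "z \<in> (\<lambda>s. (s - c) ^ e) ` {s. poly P s = 0}" by (intro image_eqI[of _ _ "w + c"]) auto
  next
    fix s assume "poly P s = 0"
    then show "poly Q ((s - c) ^ e) = 0" by (simp add: polyQ R_def poly_pcompose)
  qed
  also have "card \<dots> \<le> card (\<phi> ` {s. poly P s = 0})"
  proof (rule card_image_le_card_image)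
    show "finite (\<phi> ` {s. poly P s = 0})" using poly_roots_finite[OF P0] by simp
    fix s s' assume "s \<in> {s. poly P s = 0}" "s' \<in> {s. poly P s = 0}" "\<phi> s = \<phi> s'"
    then obtain \<omega> b where \<omega>: "\<omega> \<noteq> 0" and inv: "pcompose P [:b, \<omega>:] = P" and s': "s' = b + \<omega> * s"
      using \<phi> by blast
    define \<beta> where "\<beta> = \<omega> * c + b - c"
    have "pcompose R [:\<beta>, \<omega>:] = pcompose P (pcompose [:b, \<omega>:] [:c, 1:])"
      unfolding R_def pcompose_assoc[symmetric] by (simp add: pcompose_pCons \<beta>_def algebra_simps)
    also have "\<dots> = R" by (simp only: pcompose_assoc inv R_def)
    finally have R: "pcompose R [:\<beta>, \<omega>:] = R" .
    \<comment> \<open>The second coefficient of \<open>R\<close> is zero, while that of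
      \<open>R(\<beta> + \<omega> z)\<close> is a nonzero multiple of \<open>\<beta>\<close> in
      characteristic 0.\<close>
    have "\<beta> = 0"
      using coeff_pcompose_linear_second[of R m \<beta> \<omega>] degR subR lcR \<omega> by (simp add: R del: of_nat_Suc)
    then have "\<omega> ^ i * coeff R i = coeff R i" for i
      using arg_cong[OF R, of "\<lambda>p. coeff p i"] by (simp add: coeff_pcompose_linear)
    then have "\<omega> \<in> \<Omega>" by (auto simp: \<Omega>_def)
    moreover have "s' - c = \<omega> * (s - c)" using \<open>\<beta> = 0\<close> by (simp add: \<beta>_def s' algebra_simps)
    ultimately show "(s - c) ^ e = (s' - c) ^ e" using e(2) by (simp add: power_mult_distrib)
  qed
  finally show ?thesis .
qed

section \<open>Balls and residue polynomials\<close>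

definition integral_expansion :: "'a::field fls poly \<Rightarrow> 'a fls \<Rightarrow> int \<Rightarrow> 'a fps poly \<Rightarrow> bool" where
  "integral_expansion F \<gamma> h G \<longleftrightarrow>
     pcompose F [:\<gamma>, fls_X_intpow h:] = map_poly fps_to_fls G \<and> degree (residue_poly G) > 0"

definition puiseux_ball :: "'a::field fls \<Rightarrow> int \<Rightarrow> 'a fls set" where
  "puiseux_ball \<gamma> h = range (\<lambda>b. \<gamma> + fls_X_intpow h * fps_to_fls b)"

lemma poly_integral_expansion:
  assumes "integral_expansion F \<gamma> h G"
  shows "poly F (\<gamma> + fls_X_intpow h * fps_to_fls b) = fps_to_fls (poly G b)"
proof -
  have "poly F (\<gamma> + fls_X_intpow h * fps_to_fls b) = poly (pcompose F [:\<gamma>, fls_X_intpow h:]) (fps_to_fls b)"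
    by (simp add: poly_pcompose mult.commute)
  with assms show ?thesis
    by (simp add: integral_expansion_def fps_to_fls_hom.poly_map_poly_hom)
qed

text \<open>By the chain rule, differentiating \<open>F(\<gamma> + t^h s)\<close> in
  \<open>s\<close> only brings in the factor \<open>t^h\<close>, and differentiation commutes with
  reduction at \<open>t = 0\<close>.\<close>

lemma critical_point_integral_expansion:
  assumes G: "integral_expansion F \<gamma> h G"
    and crit: "poly (pderiv F) (\<gamma> + fls_X_intpow h * fps_to_fls b) = 0"
  shows "poly (pderiv (residue_poly G)) (fps_nth b 0) = 0"
proof -
  have "map_poly fps_to_fls (pderiv G) = pcompose (pderiv F) [:\<gamma>, fls_X_intpow h:] * [:fls_X_intpow h:]"
    using G by (simp add: integral_expansion_def fps_to_fls_hom.map_poly_hom_pderiv pderiv_pcompose pderiv_pCons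
        flip: G[unfolded integral_expansion_def, THEN conjunct1])
  then have "poly (map_poly fps_to_fls (pderiv G)) (fps_to_fls b) = 0"
    using crit by (simp add: poly_pcompose mult.commute)
  then have "poly (pderiv G) b = 0" by (simp add: fps_to_fls_hom.poly_map_poly_hom)
  then show ?thesis
    by (simp add: fps_nth_0_hom.poly_map_poly_hom flip: fps_nth_0_hom.map_poly_hom_pderiv)
qed

lemma integral_expansion_unique:
  assumes "integral_expansion F \<gamma> h G" "integral_expansion F \<gamma> h G'"
  shows "G = G'"
  using assms by (simp add: integral_expansion_def fps_to_fls_hom.map_poly_hom_eq_iff)

lemma integral_expansion_shift:
  assumes "integral_expansion F \<gamma> h G"
  shows "integral_expansion F (\<gamma> + fls_X_intpow h * fps_to_fls b) h (pcompose G [:b, 1:])"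
proof -
  have "[:\<gamma> + fls_X_intpow h * fps_to_fls b, fls_X_intpow h:] = pcompose [:\<gamma>, fls_X_intpow h:] [:fps_to_fls b, 1:]"
    by (simp add: pcompose_pCons mult.commute)
  with assms show ?thesis
    by (simp add: integral_expansion_def fps_to_fls_hom.map_poly_hom_pcompose
        fps_nth_0_hom.map_poly_hom_pcompose degree_pcompose pcompose_assoc)
qed

text \<open>Replacing \<open>h\<close> by \<open>h + k\<close> with \<open>k > 0\<close> substitutes
  \<open>t^k s\<close> for \<open>s\<close>, which leaves only a constant at
  \<open>t = 0\<close>.\<close>

lemma integral_expansion_exponent_le:
  assumes G: "integral_expansion F \<gamma> h G" and G': "integral_expansion F \<gamma> h' G'"
  shows "h' \<le> h"
proof (rule ccontr)
  assume "\<not> h' \<le> h"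
  define k where "k = nat (h' - h)"
  have k: "k > 0" "h' = h + int k" using \<open>\<not> h' \<le> h\<close> by (auto simp: k_def)
  have "(fls_X_intpow h' :: 'a fls) = fls_X_intpow h * fps_to_fls (fps_X ^ k)"
    by (simp add: k(2) fps_to_fls_power fls_X_power_conv_shift_1 fls_X_intpow_times_fls_X_intpow)
  then have "[:\<gamma>, fls_X_intpow h':] = pcompose [:\<gamma>, fls_X_intpow h:] [:0, fps_to_fls (fps_X ^ k):]"
    by (simp add: pcompose_pCons mult.commute)
  then have "map_poly fps_to_fls G' = map_poly fps_to_fls (pcompose G [:0, fps_X ^ k:])"
    using G G' by (simp add: integral_expansion_def fps_to_fls_hom.map_poly_hom_pcompose pcompose_assoc)
  then have "G' = pcompose G [:0, fps_X ^ k:]" by (simp add: fps_to_fls_hom.map_poly_hom_eq_iff)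
  then have "residue_poly G' = pcompose (residue_poly G) 0"
    using k(1) by (simp add: fps_nth_0_hom.map_poly_hom_pcompose)
  then show False using G' by (simp add: integral_expansion_def pcompose_0')
qed

lemma integral_expansion_exponent_unique:
  "integral_expansion F \<gamma> h G \<Longrightarrow> integral_expansion F \<gamma> h' G' \<Longrightarrow> h = h'"
  by (intro antisym integral_expansion_exponent_le)

text \<open>Conjugation fixes \<open>F\<close> and turns \<open>t^h\<close> into
  \<open>\<zeta>^h t^h\<close>; the constant is moved into \<open>s\<close>. Constant terms of power
  series do not change under conjugation, so only this rescaling of \<open>s\<close> is seen in the
  residue.\<close>

lemma integral_expansion_scale:
  assumes \<zeta>: "\<zeta> \<noteq> 0" and F: "map_poly (fls_scale \<zeta>) F = F" and G: "integral_expansion F \<gamma> h G"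
  shows "\<exists>G'. integral_expansion F (fls_scale \<zeta> \<gamma>) h G' \<and>
    residue_poly G = pcompose (residue_poly G') [:0, \<zeta> powi h:]"
proof -
  interpret S: inj_idom_hom "fls_scale \<zeta>" by (rule fls_scale_hom) fact
  define w where "w = \<zeta> powi h"
  have w: "w \<noteq> 0" using \<zeta> by (simp add: w_def)
  have s0: "fps_scale \<zeta> 0 = 0" by (rule fps_ext) simp
  define G1 where "G1 = map_poly (fps_scale \<zeta>) G"
  define G' where "G' = pcompose G1 [:0, fps_const (inverse w):]"
  have "map_poly fps_to_fls G1 = map_poly (fls_scale \<zeta>) (map_poly fps_to_fls G)"
    by (rule poly_eqI) (simp add: G1_def coeff_map_poly s0 fls_scale_fps_to_fls)
  also have "\<dots> = map_poly (fls_scale \<zeta>) (pcompose F [:\<gamma>, fls_X_intpow h:])"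
    using G by (simp add: integral_expansion_def)
  also have "\<dots> = pcompose F [:fls_scale \<zeta> \<gamma>, fls_const w * fls_X_intpow h:]"
    by (simp add: S.map_poly_hom_pcompose F fls_scale_X_intpow w_def)
  finally have G1: "map_poly fps_to_fls G1 = pcompose F [:fls_scale \<zeta> \<gamma>, fls_const w * fls_X_intpow h:]" .
  have "fls_const (inverse w) * (fls_const w * fls_X_intpow h) = (fls_X_intpow h :: 'a fls)"
    using w by (simp flip: mult.assoc add: fls_const_mult_const)
  then have "[:fls_scale \<zeta> \<gamma>, fls_X_intpow h:] =
      pcompose [:fls_scale \<zeta> \<gamma>, fls_const w * fls_X_intpow h:] [:0, fls_const (inverse w):]"
    using w by (simp add: pcompose_pCons)
  then have "pcompose F [:fls_scale \<zeta> \<gamma>, fls_X_intpow h:] = map_poly fps_to_fls G'"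
    by (simp add: G'_def fps_to_fls_hom.map_poly_hom_pcompose G1 pcompose_assoc)
  moreover have r1: "residue_poly G1 = residue_poly G"
    by (rule poly_eqI) (simp add: G1_def coeff_map_poly s0)
  then have r': "residue_poly G' = pcompose (residue_poly G) [:0, inverse w:]"
    by (simp add: G'_def fps_nth_0_hom.map_poly_hom_pcompose)
  then have "degree (residue_poly G') > 0"
    using G w by (simp add: integral_expansion_def degree_pcompose)
  moreover have "pcompose (residue_poly G') [:0, w:] = residue_poly G"
    unfolding r' pcompose_assoc[symmetric] using w by (simp add: pcompose_pCons)
  ultimately show ?thesis unfolding w_def integral_expansion_def by metis
qed

text \<open>
  If no root of \<open>F\<close> were that close, every linear factor would be, up to a constant, of the form
  \<open>1 + r s\<close> with \<open>r\<close> integral, so that the constant coefficient of the expansion would divide all others.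
\<close>
lemma residue_root_lifts:
  fixes F :: "'a::field fls poly"
  assumes F: "F = (\<Prod>z\<in>#A. [:- z, 1:])" and G: "integral_expansion F \<gamma> h G"
    and s: "poly (residue_poly G) s = 0"
  shows "\<exists>b. fps_nth b 0 = s \<and> poly F (\<gamma> + fls_X_intpow h * fps_to_fls b) = 0"
proof (rule ccontr)
  assume no: "\<not> ?thesis"
  define \<gamma>' where "\<gamma>' = \<gamma> + fls_X_intpow h * fps_to_fls (fps_const s)"
  define G' where "G' = pcompose G [:fps_const s, 1:]"
  have G': "integral_expansion F \<gamma>' h G'"
    unfolding \<gamma>'_def G'_def by (rule integral_expansion_shift[OF G])
  \<comment> \<open>A root \<open>z\<close> with \<open>z - \<gamma>'\<close> zero or of order above
    \<open>h\<close> would be \<open>\<gamma> + t^h b\<close> with \<open>b\<close> of constant term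
    \<open>s\<close>, which \<open>no\<close> excludes.\<close>
  have far: "\<gamma>' - z \<noteq> 0 \<and> fls_subdegree (\<gamma>' - z) \<le> h" if z: "z \<in># A" for z
  proof (rule ccontr)
    assume "\<not> (\<gamma>' - z \<noteq> 0 \<and> fls_subdegree (\<gamma>' - z) \<le> h)"
    then have far: "\<gamma>' - z = 0 \<or> fls_subdegree (\<gamma>' - z) > h" by auto
    define c where "c = fls_X_intpow (- h) * (z - \<gamma>')"
    have c: "z = \<gamma>' + fls_X_intpow h * c"
      unfolding c_def mult.assoc[symmetric] fls_X_intpow_times_fls_X_intpow by simp
    have c0: "c $$ k = 0" if "k \<le> 0" for k
    proof -
      have "c $$ k = (z - \<gamma>') $$ (k + h)" unfolding c_def fls_X_intpow_times_conv_shift by simp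
      also have "\<dots> = - ((\<gamma>' - z) $$ (k + h))" by simp
      also have "(\<gamma>' - z) $$ (k + h) = 0" using far that by (elim disjE) (simp, intro fls_eq0_below_subdegree, simp)
      finally show ?thesis by simp
    qed
    then have "fls_subdegree c \<ge> 0" by (intro fls_subdegree_ge0I) simp
    then have "fps_to_fls (fls_regpart c) = c" by simp
    with c have "z = \<gamma> + fls_X_intpow h * fps_to_fls (fps_const s + fls_regpart c)"
      unfolding \<gamma>'_def by (simp add: algebra_simps)
    moreover have "fps_nth (fps_const s + fls_regpart c) 0 = s" using c0[of 0] by simp
    moreover have "poly F z = 0" unfolding F using z
      by (auto simp: poly_prod_mset prod_mset_zero_iff)
    ultimately show False using no by metis
  qed
  \<comment> \<open>Stated for submultisets of \<open>A\<close> so that \<open>far\<close> stays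
    available for each root added in the induction.\<close>
  have "\<exists>W. coeff W 0 = 1 \<and> (\<Prod>z\<in>#B. [:\<gamma>' - z, fls_X_intpow h:]) =
      smult (\<Prod>z\<in>#B. \<gamma>' - z) (map_poly fps_to_fls W)" if "B \<subseteq># A" for B
    using that
  proof (induction B)
    case empty
    show ?case by (intro exI[of _ 1]) simp
  next
    case (add z B)
    from add obtain W where W: "coeff W 0 = 1" "(\<Prod>z\<in>#B. [:\<gamma>' - z, fls_X_intpow h:]) =
      smult (\<Prod>z\<in>#B. \<gamma>' - z) (map_poly fps_to_fls W)"
      by (meson mset_subset_eq_insertD subset_mset.less_imp_le)
    have z: "z \<in># A" using add.prems by (meson insert_subset_eq_iff)
    define r where "r = fls_X_intpow h / (\<gamma>' - z)"
    have "fls_subdegree r = h - fls_subdegree (\<gamma>' - z)"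
      unfolding r_def using far[OF z] by (subst fls_divide_subdegree) auto
    then have "fls_subdegree r \<ge> 0" using far[OF z] by simp
    then have r: "fps_to_fls (fls_regpart r) = r" by simp
    have "[:\<gamma>' - z, fls_X_intpow h:] = smult (\<gamma>' - z) (map_poly fps_to_fls [:1, fls_regpart r:])"
    proof -
      have "(\<gamma>' - z) * r = fls_X_intpow h" using far[OF z] by (simp add: r_def)
      then show ?thesis by (simp add: r)
    qed
    then have "(\<Prod>z\<in>#add_mset z B. [:\<gamma>' - z, fls_X_intpow h:]) =
        smult (\<Prod>z\<in>#add_mset z B. \<gamma>' - z) (map_poly fps_to_fls ([:1, fls_regpart r:] * W))"
      by (simp only: image_mset_add_mset prod_mset.add_mset W(2) fps_to_fls_hom.map_poly_hom_mult
          mult_smult_left mult_smult_right smult_smult mult_ac)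
    then show ?case using W(1) by (intro exI[of _ "[:1, fls_regpart r:] * W"] conjI) (simp add: coeff_mult_0)
  qed
  from this[of A] obtain W where W: "coeff W 0 = 1"
    "(\<Prod>z\<in>#A. [:\<gamma>' - z, fls_X_intpow h:]) = smult (\<Prod>z\<in>#A. \<gamma>' - z) (map_poly fps_to_fls W)" by auto
  have "pcompose (\<Prod>z\<in>#A. [:- z, 1:]) [:\<gamma>', fls_X_intpow h:] = (\<Prod>z\<in>#A. [:\<gamma>' - z, fls_X_intpow h:])"
    by (induction A) (simp_all add: pcompose_1 pcompose_mult pcompose_pCons del: mult_pCons_left)
  then have eq: "map_poly fps_to_fls G' = smult (\<Prod>z\<in>#A. \<gamma>' - z) (map_poly fps_to_fls W)"
    using G' W(2) F by (simp add: integral_expansion_def)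
  have "fps_to_fls (coeff G' 0) = (\<Prod>z\<in>#A. \<gamma>' - z)"
    using arg_cong[OF eq, of "\<lambda>p. coeff p 0"] W(1) by simp
  with eq have "map_poly fps_to_fls G' = map_poly fps_to_fls (smult (coeff G' 0) W)"
    by (simp add: fps_to_fls_hom.map_poly_hom_smult)
  then have G'W: "G' = smult (coeff G' 0) W" by (simp add: fps_to_fls_hom.map_poly_hom_eq_iff)
  \<comment> \<open>As \<open>s\<close> is a root of the residue, the common divisor
    \<open>coeff G' 0\<close> vanishes at \<open>t = 0\<close>, and with it the whole residue, whose
    degree is positive.\<close>
  have "fps_nth (coeff G' 0) 0 = poly (residue_poly G') 0" by (simp add: poly_0_coeff_0)
  also have "\<dots> = 0" using s by (simp add: G'_def fps_nth_0_hom.map_poly_hom_pcompose poly_pcompose)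
  finally have "residue_poly G' = 0"
    by (subst G'W) (simp add: fps_nth_0_hom.map_poly_hom_smult)
  with G' show False by (simp add: integral_expansion_def)
qed

text \<open>The slope is taken over the exponents \<open>i > 0\<close> only, so that the residue is
  nonconstant; the coefficient at \<open>i = 0\<close> is \<open>F(\<gamma>)\<close>, integral by
  assumption. Orders divisible by the factorial of the degree make the slope an integer.\<close>

lemma integral_expansion_exists:
  fixes F :: "'a::field fls poly"
  assumes monic: "lead_coeff F = 1" and deg: "degree F > 0"
    and dvd: "\<And>i. int (fact (degree F)) dvd fls_subdegree (coeff (pcompose F [:\<gamma>, 1:]) i)"
    and v: "poly F \<gamma> = fps_to_fls v"
  shows "\<exists>h G. integral_expansion F \<gamma> h G"
proof -
  define F1 where "F1 = pcompose F [:\<gamma>, 1:]"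
  define d where "d = degree F"
  define I where "I = {i. 0 < i \<and> i \<le> d \<and> coeff F1 i \<noteq> 0}"
  have lc: "coeff F1 d = 1"
    using coeff_pcompose_linear_top[of F d \<gamma> 1] monic by (simp add: F1_def d_def)
  have degF1: "degree F1 = d" by (simp add: F1_def d_def degree_pcompose)
  have "\<exists>h. (\<forall>i\<in>I. int i * h \<le> fls_subdegree (coeff F1 i)) \<and>
      (\<exists>i\<in>I. int i * h = fls_subdegree (coeff F1 i))"
  proof (rule max_slope)
    have "d \<in> I" using lc deg by (simp add: I_def d_def)
    then show "I \<noteq> {}" by blast
    fix i assume "i \<in> I"
    then have "i dvd fact (degree F)" by (intro dvd_fact) (auto simp: I_def d_def)
    then have "int i dvd int (fact (degree F))" by (simp only: of_nat_dvd_iff)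
    then show "int i dvd fls_subdegree (coeff F1 i)"
      unfolding F1_def using dvd by (rule dvd_trans)
  qed (auto simp: I_def)
  then obtain h i0 where h: "\<And>i. i \<in> I \<Longrightarrow> int i * h \<le> fls_subdegree (coeff F1 i)"
    and i0: "i0 \<in> I" "int i0 * h = fls_subdegree (coeff F1 i0)" by blast
  \<comment> \<open>The exponent of the ball is the negative of the slope \<open>h\<close>.\<close>
  define F2 where "F2 = pcompose F [:\<gamma>, fls_X_intpow (- h):]"
  have "[:\<gamma>, fls_X_intpow (- h):] = pcompose [:\<gamma>, 1:] [:0, fls_X_intpow (- h):]"
    by (simp add: pcompose_pCons)
  then have F2: "coeff F2 i = fls_X_intpow (- (int i * h)) * coeff F1 i" for i
    by (simp only: F2_def F1_def pcompose_assoc coeff_pcompose_linear fls_X_intpow_power mult_minus_right)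
  have sub: "fls_subdegree (coeff F2 i) = fls_subdegree (coeff F1 i) - int i * h" if "coeff F1 i \<noteq> 0" for i
    unfolding F2 using that by (subst fls_subdegree_mult_fls_X_intpow) simp_all
  have "fls_subdegree (coeff F2 i) \<ge> 0" for i
  proof -
    consider "coeff F1 i = 0" | "coeff F1 i \<noteq> 0" "i = 0" | "i \<in> I"
      using coeff_eq_0[of F1 i] degF1 by (fastforce simp: I_def)
    then show ?thesis
    proof cases
      case 1
      then show ?thesis by (simp add: F2)
    next
      case 2
      have "coeff F1 0 = fps_to_fls v"
        using v by (simp add: F1_def poly_0_coeff_0[symmetric] poly_pcompose)
      then show ?thesis using 2 sub[of i] by (simp add: fls_subdegree_fls_to_fps_gt0)
    next
      case 3
      then show ?thesis using sub[of i] h[of i] by (simp add: I_def)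
    qed
  qed
  from integral_poly_conv[OF this] obtain G where G: "F2 = map_poly fps_to_fls G" by blast
  have "fls_subdegree (coeff F2 i0) = 0" using sub[of i0] i0 by (simp add: I_def)
  moreover have "coeff F2 i0 \<noteq> 0" using i0(1) by (simp add: F2 I_def fls_shift_eq0_iff)
  ultimately have "coeff F2 i0 $$ 0 \<noteq> 0" by (metis nth_fls_subdegree_nonzero)
  then have "coeff (residue_poly G) i0 \<noteq> 0" by (simp add: G)
  then have "i0 \<le> degree (residue_poly G)" by (rule le_degree)
  then have "degree (residue_poly G) > 0" using i0(1) by (simp add: I_def)
  with G show ?thesis unfolding integral_expansion_def F2_def by blast
qed

section \<open>Irregular values\<close>

lemma dvd_prod_linear_imp_root:
  fixes p :: "'a::field poly"
  assumes "p dvd (\<Prod>z\<in>#A. [:- z, 1:])" "degree p > 0"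
  shows "\<exists>z\<in>#A. poly p z = 0"
  using assms
proof (induction A)
  case empty
  then have "p dvd 1" by simp
  then have "degree p = 0" by (metis dvd_0_left is_unit_iff_degree zero_neq_one)
  with empty show ?case by simp
next
  case (add a A)
  show ?case
  proof (cases "poly p a = 0")
    case False
    from add.prems(1) obtain q where q: "[:- a, 1:] * (\<Prod>z\<in>#A. [:- z, 1:]) = p * q"
      by (auto elim!: dvdE simp del: mult_pCons_left)
    have "poly ([:- a, 1:] * (\<Prod>z\<in>#A. [:- z, 1:])) a = 0" by simp
    then have "poly q a = 0" unfolding q using False by simp
    then obtain q' where "q = [:- a, 1:] * q'" by (metis dvdE poly_eq_0_iff_dvd)
    with q have "[:- a, 1:] * (\<Prod>z\<in>#A. [:- z, 1:]) = [:- a, 1:] * (p * q')"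
      by (simp only: mult_ac)
    moreover have "[:- a, 1:] \<noteq> 0" by simp
    ultimately have "(\<Prod>z\<in>#A. [:- z, 1:]) = p * q'" using mult_left_cancel by blast
    with add show ?thesis by auto
  qed auto
qed

text \<open>Each distinct set \<open>X k\<close> pays for the labels that share it, and distinct
  ones are disjoint, so no element of \<open>C\<close> pays twice.\<close>

lemma card_le_card_Union_fibres:
  assumes "finite L" "finite C"
    and X: "\<And>l. l \<in> L \<Longrightarrow> X l \<subseteq> C"
    and disj: "\<And>k l. k \<in> L \<Longrightarrow> l \<in> L \<Longrightarrow> X k \<inter> X l \<noteq> {} \<Longrightarrow> X k = X l"
    and fibre: "\<And>k. k \<in> L \<Longrightarrow> card {l \<in> L. X l = X k} \<le> card (X k)"
  shows "card L \<le> card C"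
proof -
  have "card L = (\<Sum>Z\<in>X ` L. card {l \<in> L. X l = Z})"
    using sum.image_gen[OF assms(1), of "\<lambda>_. 1::nat" X] by simp
  also have "\<dots> \<le> (\<Sum>Z\<in>X ` L. card Z)" using fibre by (intro sum_mono) auto
  also have "\<dots> = card (\<Union> (X ` L))"
  proof (rule card_Union_disjoint[symmetric])
    show "pairwise disjnt (X ` L)" using disj by (auto simp: pairwise_def disjnt_def)
    show "finite Z" if "Z \<in> X ` L" for Z
      using that X assms(2) by (auto intro: finite_subset)
  qed
  also have "\<dots> \<le> card C" using X assms(2) by (intro card_mono) auto
  finally show ?thesis .
qed

section \<open>Ultrametric balls and the counting of components\<close>

lemma mem_puiseux_ballE:
  assumes "y \<in> puiseux_ball \<gamma> h"
  obtains b where "y = \<gamma> + fls_X_intpow h * fps_to_fls b"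
  using assms by (auto simp: puiseux_ball_def)

lemma puiseux_ball_eq:
  assumes "z \<in> puiseux_ball \<gamma> h"
  shows "puiseux_ball z h = puiseux_ball \<gamma> h"
proof -
  from assms obtain b where z: "z = \<gamma> + fls_X_intpow h * fps_to_fls b" by (rule mem_puiseux_ballE)
  have 1: "z + fls_X_intpow h * fps_to_fls c = \<gamma> + fls_X_intpow h * fps_to_fls (b + c)" for c
    by (simp add: z algebra_simps)
  have 2: "\<gamma> + fls_X_intpow h * fps_to_fls c = z + fls_X_intpow h * fps_to_fls (c - b)" for c
    by (simp add: z algebra_simps)
  show ?thesis unfolding puiseux_ball_def
  proof (intro antisym image_subsetI)
    fix c
    show "z + fls_X_intpow h * fps_to_fls c \<in> range (\<lambda>b. \<gamma> + fls_X_intpow h * fps_to_fls b)"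
      by (subst 1) (rule rangeI)
    show "\<gamma> + fls_X_intpow h * fps_to_fls c \<in> range (\<lambda>b. z + fls_X_intpow h * fps_to_fls b)"
      by (subst 2) (rule rangeI)
  qed
qed

lemma puiseux_ball_sym: "z \<in> puiseux_ball \<gamma> h \<Longrightarrow> \<gamma> \<in> puiseux_ball z h"
  by (simp add: puiseux_ball_eq) (auto simp: puiseux_ball_def intro!: image_eqI[of _ _ 0])

lemma puiseux_ball_scale:
  assumes "\<zeta> \<noteq> 0" "y \<in> puiseux_ball \<gamma> h"
  shows "fls_scale \<zeta> y \<in> puiseux_ball (fls_scale \<zeta> \<gamma>) h"
proof -
  interpret S: inj_idom_hom "fls_scale \<zeta>" by (rule fls_scale_hom) fact
  from assms obtain b where y: "y = \<gamma> + fls_X_intpow h * fps_to_fls b" by (elim mem_puiseux_ballE)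
  have "fls_scale \<zeta> y = fls_scale \<zeta> \<gamma> + fls_X_intpow h * fps_to_fls (fps_const (\<zeta> powi h) * fps_scale \<zeta> b)"
    by (simp add: y S.hom_add S.hom_mult fls_scale_X_intpow fls_scale_fps_to_fls fls_times_fps_to_fls mult_ac)
  then show ?thesis by (auto simp: puiseux_ball_def)
qed

text \<open>The counting, separated from the choice of \<open>N\<close> and of a critical point for
  each value. The components are the minimal polynomials \<open>mp y\<close> of the roots of
  \<open>F\<close>, and two roots give the same one exactly when they are conjugate.\<close>

lemma card_le_card_irreducible_components:
  fixes f :: "'a::{alg_closed_field,field_char_0} fls poly" and \<gamma> :: "'a \<Rightarrow> 'a fls"
  assumes N: "N > 0" and monic: "lead_coeff f = 1"
    and split: "map_poly (subst_power N) f = (\<Prod>z\<in>#A. [:- z, 1:])"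
    and finL: "finite L"
    and G: "\<And>l. l \<in> L \<Longrightarrow> integral_expansion (map_poly (subst_power N) f) (\<gamma> l) (h l) (G l)"
    and crit: "\<And>l. l \<in> L \<Longrightarrow> poly (pderiv (map_poly (subst_power N) f)) (\<gamma> l) = 0"
    and val: "\<And>l. l \<in> L \<Longrightarrow> poly (map_poly (subst_power N) f) (\<gamma> l) $$ 0 = l"
    and nz: "0 \<notin> L"
  shows "card L \<le> card (irreducible_components f)"
proof -
  interpret N: inj_idom_hom "subst_power N :: 'a fls \<Rightarrow> _" by (rule subst_power_hom) fact
  define F where "F = map_poly (subst_power N) f"
  have f0: "f \<noteq> 0" using monic by auto
  have F0: "F \<noteq> 0" using f0 by (simp add: F_def)
  have FA: "F = (\<Prod>z\<in>#A. [:- z, 1:])" by (simp add: F_def split)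
  have G': "integral_expansion F (\<gamma> l) (h l) (G l)" if "l \<in> L" for l
    using G[OF that] by (simp add: F_def)
  define roots where "roots = {y. poly F y = 0}"
  have ex_mp: "\<exists>m. lead_coeff m = 1 \<and> irreducible m \<and> (\<forall>p. poly (map_poly (subst_power N) p) y = 0 \<longleftrightarrow> m dvd p)"
    if "y \<in> roots" for y
    using minimal_polynomial_exists[OF N.idom_hom_axioms f0] that by (simp add: roots_def F_def)
  define mp :: "'a fls \<Rightarrow> 'a fls poly" where "mp y = (SOME m. lead_coeff m = 1 \<and> irreducible m \<and>
    (\<forall>p. poly (map_poly (subst_power N) p) y = 0 \<longleftrightarrow> m dvd p))" for y
  have mp: "lead_coeff (mp y) = 1" "irreducible (mp y)"
    "\<And>p. poly (map_poly (subst_power N) p) y = 0 \<longleftrightarrow> mp y dvd p" if "y \<in> roots" for y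
    using someI_ex[OF ex_mp[OF that]] unfolding mp_def by blast+
  have comps: "irreducible_components f = mp ` roots"
  proof
    show "mp ` roots \<subseteq> irreducible_components f"
    proof (rule image_subsetI)
      fix y assume y: "y \<in> roots"
      then have "mp y dvd f" using mp(3)[OF y, of f] by (simp add: roots_def F_def)
      with mp(1,2)[OF y] f0 show "mp y \<in> irreducible_components f"
        by (simp add: irreducible_components_def)
    qed
    show "irreducible_components f \<subseteq> mp ` roots"
    proof
      fix H assume "H \<in> irreducible_components f"
      then have H: "lead_coeff H = 1" "irreducible H" "H dvd f" by (auto simp: irreducible_components_def)
      have HF: "map_poly (subst_power N) H dvd F" unfolding F_def by (rule N.map_poly_hom_dvd) fact
      then obtain y where y: "poly (map_poly (subst_power N) H) y = 0"
        using dvd_prod_linear_imp_root[of "map_poly (subst_power N) H" A]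
          irreducible_poly_degree_pos[OF H(2)] by (auto simp: FA)
      then have "y \<in> roots" using HF by (auto simp: roots_def elim!: dvdE)
      moreover from this have "mp y = H"
        using y mp(1,2) mp(3)[of y H] H by (intro monic_irreducible_dvd_imp_eq) simp_all
      ultimately show "H \<in> mp ` roots" by blast
    qed
  qed
  have fin_comps: "finite (irreducible_components f)"
    unfolding comps roots_def using poly_roots_finite[OF F0] by simp
  have unit_nz: "\<zeta> \<noteq> 0" if "\<zeta> ^ N = 1" for \<zeta> :: 'a using that N by (metis power_0_left less_irrefl zero_neq_one)
  have inv: "map_poly (fls_scale \<zeta>) (map_poly (subst_power N) p) = map_poly (subst_power N) p"
    if z: "\<zeta> ^ N = 1" for \<zeta> :: 'a and p
  proof -
    interpret S: inj_idom_hom "fls_scale \<zeta>" by (rule fls_scale_hom) (rule unit_nz[OF z])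
    show ?thesis by (rule poly_eqI) (simp add: fls_scale_subst_power[OF N z])
  qed
  have scale_roots: "poly (map_poly (subst_power N) p) (fls_scale \<zeta> y) = fls_scale \<zeta> (poly (map_poly (subst_power N) p) y)"
    if z: "\<zeta> ^ N = 1" for \<zeta> :: 'a and p y
  proof -
    interpret S: inj_idom_hom "fls_scale \<zeta>" by (rule fls_scale_hom) (rule unit_nz[OF z])
    show ?thesis using S.poly_map_poly_hom[of "map_poly (subst_power N) p" y] by (simp add: inv[OF z])
  qed
  have scale_0 [simp]: "fls_scale \<zeta> 0 = 0" for \<zeta> :: 'a by (rule fls_eqI) simp
  have scale_mem: "fls_scale \<zeta> y \<in> roots" if "y \<in> roots" "\<zeta> ^ N = 1" for \<zeta> y
    using that by (simp add: roots_def F_def scale_roots)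
  have scale_mp: "mp (fls_scale \<zeta> y) = mp y" if y: "y \<in> roots" and z: "\<zeta> ^ N = 1" for \<zeta> y
  proof -
    have "poly (map_poly (subst_power N) (mp y)) y = 0" using mp(3)[OF y] by simp
    then have "poly (map_poly (subst_power N) (mp y)) (fls_scale \<zeta> y) = 0" by (simp add: scale_roots[OF z])
    then have "mp (fls_scale \<zeta> y) dvd mp y" using mp(3)[OF scale_mem[OF y z]] by blast
    then show ?thesis using mp(1,2) y scale_mem[OF y z] by (intro monic_irreducible_dvd_imp_eq) auto
  qed
  have conj: "\<exists>\<zeta>. \<zeta> ^ N = 1 \<and> y' = fls_scale \<zeta> y" if "y \<in> roots" "y' \<in> roots" "mp y = mp y'" for y y'
    using roots_of_irreducible_conjugate[OF N, of y "mp y" y'] mp(3) that by simp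

  \<comment> \<open>\<open>X l\<close> is the set of components with a root in the ball of \<open>l\<close>; these sets are equal when
    the balls are conjugate and disjoint otherwise, so it suffices to bound each fibre of \<open>X\<close>.\<close>
  define X where "X l = mp ` (roots \<inter> puiseux_ball (\<gamma> l) (h l))" for l
  \<comment> \<open>Conjugation carries \<open>y\<close> to \<open>y'\<close>. Expansions exist
    around \<open>y'\<close> with both exponents, so these agree, and two balls of the same exponent
    with a common point coincide.\<close>
  have meet: "\<exists>\<zeta>. \<zeta> ^ N = 1 \<and> h k = h l \<and> y' = fls_scale \<zeta> y \<and> fls_scale \<zeta> (\<gamma> k) \<in> puiseux_ball (\<gamma> l) (h l)"
    if k: "k \<in> L" and l: "l \<in> L" and y: "y \<in> roots" "y \<in> puiseux_ball (\<gamma> k) (h k)"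
      and y': "y' \<in> roots" "y' \<in> puiseux_ball (\<gamma> l) (h l)" and eq: "mp y = mp y'" for k l y y'
  proof -
    obtain \<zeta> where z: "\<zeta> ^ N = 1" "y' = fls_scale \<zeta> y" using conj[OF y(1) y'(1) eq] by blast
    have yk: "y' \<in> puiseux_ball (fls_scale \<zeta> (\<gamma> k)) (h k)"
      unfolding z(2) using unit_nz[OF z(1)] y(2) by (rule puiseux_ball_scale)
    have "map_poly (fls_scale \<zeta>) F = F" by (simp add: F_def inv[OF z(1)])
    then obtain G1 where G1: "integral_expansion F (fls_scale \<zeta> (\<gamma> k)) (h k) G1"
      using integral_expansion_scale[OF unit_nz[OF z(1)] _ G'[OF k]] by blast
    obtain b where "y' = fls_scale \<zeta> (\<gamma> k) + fls_X_intpow (h k) * fps_to_fls b" using yk by (rule mem_puiseux_ballE)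
    then have "integral_expansion F y' (h k) (pcompose G1 [:b, 1:])"
      using integral_expansion_shift[OF G1] by simp
    moreover obtain c where "y' = \<gamma> l + fls_X_intpow (h l) * fps_to_fls c" using y'(2) by (rule mem_puiseux_ballE)
    then have "integral_expansion F y' (h l) (pcompose (G l) [:c, 1:])"
      using integral_expansion_shift[OF G'[OF l]] by simp
    ultimately have hkl: "h k = h l" by (rule integral_expansion_exponent_unique)
    have "fls_scale \<zeta> (\<gamma> k) \<in> puiseux_ball y' (h k)" using yk by (rule puiseux_ball_sym)
    then have "fls_scale \<zeta> (\<gamma> k) \<in> puiseux_ball (\<gamma> l) (h l)"
      using puiseux_ball_eq[OF y'(2)] hkl by simp
    with z hkl show ?thesis by blast
  qed
  have subset: "X k \<subseteq> X l" if "k \<in> L" "l \<in> L" "X k \<inter> X l \<noteq> {}" for k l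
  proof
    fix H assume "H \<in> X k"
    then obtain w where w: "w \<in> roots" "w \<in> puiseux_ball (\<gamma> k) (h k)" "H = mp w" by (auto simp: X_def)
    from that(3) obtain y y' where "y \<in> roots" "y \<in> puiseux_ball (\<gamma> k) (h k)"
      "y' \<in> roots" "y' \<in> puiseux_ball (\<gamma> l) (h l)" "mp y = mp y'" by (force simp: X_def)
    from meet[OF that(1,2) this] obtain \<zeta> where z: "\<zeta> ^ N = 1" "h k = h l"
      "fls_scale \<zeta> (\<gamma> k) \<in> puiseux_ball (\<gamma> l) (h l)" by blast
    have "fls_scale \<zeta> w \<in> puiseux_ball (fls_scale \<zeta> (\<gamma> k)) (h k)"
      using unit_nz[OF z(1)] w(2) by (rule puiseux_ball_scale)
    then have "fls_scale \<zeta> w \<in> puiseux_ball (\<gamma> l) (h l)" using puiseux_ball_eq[OF z(3)] z(2) by simp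
    then show "H \<in> X l"
      unfolding X_def using scale_mem[OF w(1) z(1)] scale_mp[OF w(1) z(1)] w(3) by (metis IntI image_eqI)
  qed
  show ?thesis
  proof (rule card_le_card_Union_fibres[OF finL fin_comps])
    show "X l \<subseteq> irreducible_components f" for l by (auto simp: X_def comps)
    show "X k = X l" if "k \<in> L" "l \<in> L" "X k \<inter> X l \<noteq> {}" for k l
      using subset[of k l] subset[of l k] that by (simp add: Int_commute)
  next
    fix k assume k: "k \<in> L"
    define P where "P = residue_poly (G k)"
    have degP: "degree P > 0" using G'[OF k] by (simp add: P_def integral_expansion_def)
    have "\<exists>b. fps_nth b 0 = s \<and> \<gamma> k + fls_X_intpow (h k) * fps_to_fls b \<in> roots" if "poly P s = 0" for s
      using residue_root_lifts[OF FA G'[OF k], of s] that by (auto simp: P_def roots_def)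
    then obtain b where b: "\<And>s. poly P s = 0 \<Longrightarrow> fps_nth (b s) 0 = s"
      "\<And>s. poly P s = 0 \<Longrightarrow> \<gamma> k + fls_X_intpow (h k) * fps_to_fls (b s) \<in> roots" by metis
    \<comment> \<open>One root of \<open>F\<close> over each residue \<open>s\<close>. Other roots
      over \<open>s\<close> may lie on other components, but one per residue suffices for a lower
      bound on \<open>card (X k)\<close>.\<close>
    define y where "y s = \<gamma> k + fls_X_intpow (h k) * fps_to_fls (b s)" for s
    have y: "y s \<in> roots" "y s \<in> puiseux_ball (\<gamma> k) (h k)" if "poly P s = 0" for s
      using b(2)[OF that] by (auto simp: y_def puiseux_ball_def)
    have fin_Xk: "finite (X k)" using fin_comps by (rule finite_subset[rotated]) (auto simp: X_def comps)
    \<comment> \<open>A common component yields a conjugate of \<open>\<gamma> l\<close> in the ball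
      of \<open>k\<close>. Conjugation preserves the constant term of \<open>F(\<gamma> l)\<close>
      and the vanishing of the derivative, so \<open>l\<close> is a critical value of
      \<open>P\<close>.\<close>
    have "{l \<in> L. X l = X k} \<subseteq> poly P ` {z. poly (pderiv P) z = 0 \<and> poly P z \<noteq> 0}"
    proof safe
      fix l assume l: "l \<in> L" "X l = X k"
      obtain s where "poly P s = 0" using alg_closed_imp_poly_has_root[OF degP] by blast
      then have "mp (y s) \<in> X l" unfolding l(2) using y by (auto simp: X_def)
      then obtain w where w: "w \<in> roots" "w \<in> puiseux_ball (\<gamma> l) (h l)" "mp w = mp (y s)" by (auto simp: X_def)
      with meet[OF l(1) k w(1,2) y[OF \<open>poly P s = 0\<close>]] obtain \<zeta> where z: "\<zeta> ^ N = 1"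
        "fls_scale \<zeta> (\<gamma> l) \<in> puiseux_ball (\<gamma> k) (h k)" by blast
      from z(2) obtain c where c: "fls_scale \<zeta> (\<gamma> l) = \<gamma> k + fls_X_intpow (h k) * fps_to_fls c" by (rule mem_puiseux_ballE)
      have "l = poly F (\<gamma> l) $$ 0" using val[OF l(1)] by (simp add: F_def)
      also have "\<dots> = poly F (fls_scale \<zeta> (\<gamma> l)) $$ 0" by (simp add: F_def scale_roots[OF z(1)])
      also have "\<dots> = poly P (fps_nth c 0)"
        by (simp add: c poly_integral_expansion[OF G'[OF k]] P_def fps_nth_0_hom.poly_map_poly_hom)
      finally have lP: "l = poly P (fps_nth c 0)" .
      have "poly (pderiv F) (fls_scale \<zeta> (\<gamma> l)) = fls_scale \<zeta> (poly (pderiv F) (\<gamma> l))"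
        unfolding F_def N.map_poly_hom_pderiv[symmetric] by (rule scale_roots[OF z(1)])
      also have "\<dots> = 0" using crit[OF l(1)] by (simp add: F_def)
      finally have "poly (pderiv P) (fps_nth c 0) = 0"
        unfolding c P_def by (rule critical_point_integral_expansion[OF G'[OF k]])
      then show "l \<in> poly P ` {z. poly (pderiv P) z = 0 \<and> poly P z \<noteq> 0}"
        using lP l(1) nz by auto
    qed
    moreover have "pderiv P \<noteq> 0" using degP by (simp add: pderiv_eq_0_iff)
    then have "finite {z. poly (pderiv P) z = 0}" by (rule poly_roots_finite)
    then have "finite {z. poly (pderiv P) z = 0 \<and> poly P z \<noteq> 0}" by (rule finite_subset[rotated]) auto
    ultimately have "card {l \<in> L. X l = X k} \<le> card (poly P ` {z. poly (pderiv P) z = 0 \<and> poly P z \<noteq> 0})"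
      by (intro card_mono) auto
    also have "\<dots> \<le> card ((\<lambda>s. mp (y s)) ` {s. poly P s = 0})"
    proof (rule card_critical_values_le_card_root_classes[OF degP])
      \<comment> \<open>Conjugate roots in one ball are related by some \<open>\<zeta>\<close> that
        stabilizes the ball. In the coordinate \<open>s\<close> it acts at \<open>t = 0\<close> by
        \<open>s\<close> to \<open>c(0) + \<zeta>^h s\<close>, and this affine map preserves
        \<open>P\<close>.\<close>
      fix s s' assume s: "poly P s = 0" "poly P s' = 0" "mp (y s) = mp (y s')"
      from meet[OF k k y[OF s(1)] y[OF s(2)] s(3)] obtain \<zeta> where z: "\<zeta> ^ N = 1" "y s' = fls_scale \<zeta> (y s)"
        "fls_scale \<zeta> (\<gamma> k) \<in> puiseux_ball (\<gamma> k) (h k)" by blast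
      interpret S: inj_idom_hom "fls_scale \<zeta>" by (rule fls_scale_hom) (rule unit_nz[OF z(1)])
      from z(3) obtain c where c: "fls_scale \<zeta> (\<gamma> k) = \<gamma> k + fls_X_intpow (h k) * fps_to_fls c" by (rule mem_puiseux_ballE)
      define w where "w = \<zeta> powi h k"
      have "map_poly (fls_scale \<zeta>) F = F" by (simp add: F_def inv[OF z(1)])
      then obtain G1 where G1: "integral_expansion F (fls_scale \<zeta> (\<gamma> k)) (h k) G1"
        and PG1: "P = pcompose (residue_poly G1) [:0, w:]"
        using integral_expansion_scale[OF unit_nz[OF z(1)] _ G'[OF k]] unfolding P_def w_def by blast
      have "G1 = pcompose (G k) [:c, 1:]"
        using integral_expansion_shift[OF G'[OF k], of c] G1 unfolding c by (rule integral_expansion_unique[rotated])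
      then have "residue_poly G1 = pcompose P [:fps_nth c 0, 1:]"
        by (simp add: fps_nth_0_hom.map_poly_hom_pcompose P_def)
      then have "P = pcompose P (pcompose [:fps_nth c 0, 1:] [:0, w:])" using PG1 by (simp add: pcompose_assoc)
      then have 1: "pcompose P [:fps_nth c 0, w:] = P" by (simp add: pcompose_pCons)
      have "fls_X_intpow (h k) * fps_to_fls (b s') = fls_X_intpow (h k) * fps_to_fls (c + fps_const w * fps_scale \<zeta> (b s))"
        using z(2) by (simp add: y_def c S.hom_add S.hom_mult fls_scale_X_intpow fls_scale_fps_to_fls
            fls_times_fps_to_fls w_def algebra_simps)
      then have "fps_to_fls (b s') = fps_to_fls (c + fps_const w * fps_scale \<zeta> (b s))"
        by (subst (asm) mult_left_cancel) (simp_all add: fls_shift_eq0_iff)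
      then have "b s' = c + fps_const w * fps_scale \<zeta> (b s)" by (simp only: fps_to_fls_eq_iff)
      then have "fps_nth (b s') 0 = fps_nth c 0 + w * fps_nth (b s) 0" by simp
      then have "s' = fps_nth c 0 + w * s" using b(1) s by simp
      moreover have "w \<noteq> 0" using unit_nz[OF z(1)] by (simp add: w_def)
      ultimately show "\<exists>\<omega> b. \<omega> \<noteq> 0 \<and> pcompose P [:b, \<omega>:] = P \<and> s' = b + \<omega> * s" using 1 by blast
    qed
    also have "\<dots> \<le> card (X k)" using fin_Xk y by (intro card_mono) (auto simp: X_def)
    finally show "card {l \<in> L. X l = X k} \<le> card (X k)" .
  qed
qed

theorem corollary10p2:
  fixes f :: "'a::{alg_closed_field, field_char_0} fls poly"
  assumes monic: "lead_coeff f = 1"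
    and reduced: "squarefree f"
    and generic: "\<forall>H \<in> irreducible_components (pderiv f). int_mult f H \<le> 0"
  shows "finite (irreg f) \<and> card (irreg f) \<le> card (irreducible_components f)"
proof (cases "degree f = 0")
  case True
  \<comment> \<open>The zero polynomial has no components by convention, so \<open>irreg f\<close>
    is empty.\<close>
  then have "pderiv f = 0" by (simp add: pderiv_eq_0_iff)
  then show ?thesis by (simp add: irreg_def irreducible_components_def)
next
  case False
  obtain N0 A0 where N0: "N0 > 0" and A0: "map_poly (subst_power N0) f = (\<Prod>z\<in>#A0. [:- z, 1:])"
    using puiseux_splits[OF monic] by blast
  define D where "D = (fact (degree f) :: nat)"
  have D: "D > 0" by (simp add: D_def)
  \<comment> \<open>\<open>N0\<close> splits \<open>f\<close>. One factor \<open>D\<close> is a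
    multiple of every degree \<open>n\<close> of a component of the derivative, so that its roots
    embed in \<open>K((t))\<close>; the other \<open>D\<close> remains in \<open>q = N / n\<close>
    and makes the orders at \<open>\<gamma>\<close> divisible by the factorial.\<close>
  define N where "N = N0 * (D * D)"
  have N: "N > 0" using N0 D by (simp add: N_def)
  interpret N: inj_idom_hom "subst_power N :: 'a fls \<Rightarrow> _" by (rule subst_power_hom) fact
  interpret DD: inj_idom_hom "subst_power (D * D) :: 'a fls \<Rightarrow> _" by (rule subst_power_hom) (simp add: D)
  define F where "F = map_poly (subst_power N) f"
  have "F = map_poly (subst_power (D * D)) (\<Prod>z\<in>#A0. [:- z, 1:])"
    unfolding F_def N_def A0[symmetric] using N0 D by (simp add: map_poly_subst_power_subst_power)
  also have "\<dots> = (\<Prod>z\<in>#image_mset (subst_power (D * D)) A0. [:- z, 1:])"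
    using D by (simp add: DD.map_poly_hom_prod_mset DD.hom_1 DD.hom_uminus image_mset.compositionality comp_def)
  finally have FA: "F = (\<Prod>z\<in>#image_mset (subst_power (D * D)) A0. [:- z, 1:])" .
  have F: "lead_coeff F = 1" "degree F = degree f" using monic N by (simp_all add: F_def)
  have "\<exists>\<gamma> h G. integral_expansion F \<gamma> h G \<and> poly (pderiv F) \<gamma> = 0 \<and> poly F \<gamma> $$ 0 = l"
    if l: "l \<in> irreg f" for l
  proof -
    from l obtain H g u where H: "H \<in> irreducible_components (pderiv f)" and g: "puiseux_root H g"
      and u: "fps_nth u 0 = 0" and e: "puiseux_eval f (degree H) g = fls_const l + fps_to_fls u"
      by (auto simp: irreg_def)
    from H have H': "irreducible H" "H dvd pderiv f" "pderiv f \<noteq> 0" by (auto simp: irreducible_components_def)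
    define n where "n = degree H"
    have n: "n > 0" unfolding n_def using H'(1) by (rule irreducible_poly_degree_pos)
    have "n \<le> degree f"
      using dvd_imp_degree_le[OF H'(2,3)] degree_pderiv[of f] by (simp add: n_def)
    then have "n dvd D" unfolding D_def using n by (intro dvd_fact) auto
    then obtain k where k: "D = n * k" by (elim dvdE)
    define q where "q = N0 * k * D"
    have Nq: "N = n * q" by (simp add: N_def q_def k)
    have q: "q > 0" using N Nq by simp
    interpret n: inj_idom_hom "subst_power n :: 'a fls \<Rightarrow> _" by (rule subst_power_hom) fact
    interpret q: inj_idom_hom "subst_power q :: 'a fls \<Rightarrow> _" by (rule subst_power_hom) fact
    define \<gamma> where "\<gamma> = subst_power q g"
    have eval: "poly (map_poly (subst_power N) p) \<gamma> = subst_power q (poly (map_poly (subst_power n) p) g)" for p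
      using q.poly_map_poly_hom[of "map_poly (subst_power n) p" g]
      by (simp add: Nq \<gamma>_def map_poly_subst_power_subst_power[OF n q])
    have "poly F \<gamma> = subst_power q (fps_to_fls (fps_const l + u))"
      using e by (simp add: F_def eval puiseux_eval_def n_def)
    then have v: "poly F \<gamma> = fps_to_fls ((fps_const l + u) oo fps_X ^ q)"
      using q by (simp only: fls_compose_power_fps_to_fls)
    have "poly (map_poly (subst_power n) H) g = 0"
      using g by (simp add: puiseux_root_def puiseux_eval_def n_def)
    then have "poly (map_poly (subst_power n) (pderiv f)) g = 0"
      using H'(2) by (auto simp: n.map_poly_hom_mult elim!: dvdE)
    then have crit: "poly (pderiv F) \<gamma> = 0"
      by (simp add: F_def eval flip: N.map_poly_hom_pderiv)
    \<comment> \<open>Both \<open>F\<close> and \<open>\<gamma>\<close> arise by substituting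
      \<open>t^q\<close>, so every coefficient of the expansion has order divisible by
      \<open>q\<close>.\<close>
    have "pcompose F [:\<gamma>, 1:] = map_poly (subst_power q) (pcompose (map_poly (subst_power n) f) [:g, 1:])"
      by (simp add: q.map_poly_hom_pcompose F_def Nq map_poly_subst_power_subst_power[OF n q] \<gamma>_def q.hom_1)
    then have "int q dvd fls_subdegree (coeff (pcompose F [:\<gamma>, 1:]) i)" for i
      by (simp add: fls_subdegree_subst_power[OF q])
    moreover have "int (fact (degree F)) dvd int q" by (simp add: F(2) q_def flip: D_def)
    ultimately have "int (fact (degree F)) dvd fls_subdegree (coeff (pcompose F [:\<gamma>, 1:]) i)" for i
      by (meson dvd_trans)
    then obtain h G where "integral_expansion F \<gamma> h G"
      using integral_expansion_exists[OF F(1) _ _ v] F(2) False by auto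
    moreover have "poly F \<gamma> $$ 0 = l" using u by (simp add: v)
    ultimately show ?thesis using crit by blast
  qed
  then obtain \<gamma> h G where *: "\<And>l. l \<in> irreg f \<Longrightarrow> integral_expansion F (\<gamma> l) (h l) (G l)"
    "\<And>l. l \<in> irreg f \<Longrightarrow> poly (pderiv F) (\<gamma> l) = 0" "\<And>l. l \<in> irreg f \<Longrightarrow> poly F (\<gamma> l) $$ 0 = l"
    by metis
  \<comment> \<open>Each irregular value is the constant term of \<open>F\<close> at one of the
    finitely many zeros of its derivative; this supplies the finiteness that the counting lemma
    assumes.\<close>
  have "pderiv F \<noteq> 0" using F(2) False by (simp add: pderiv_eq_0_iff)
  then have "finite ((\<lambda>z. poly F z $$ 0) ` {z. poly (pderiv F) z = 0})"
    by (intro finite_imageI poly_roots_finite)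
  moreover have "irreg f \<subseteq> (\<lambda>z. poly F z $$ 0) ` {z. poly (pderiv F) z = 0}"
    using *(2,3) by force
  ultimately have "finite (irreg f)" by (rule finite_subset[rotated])
  moreover from this have "card (irreg f) \<le> card (irreducible_components f)"
    using card_le_card_irreducible_components[OF N monic FA[unfolded F_def], of "irreg f" \<gamma> h G] *
    by (simp add: F_def irreg_def)
  ultimately show ?thesis by blast
qed

end
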